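(* The Hausdorff completion $H$ of the group $L$ with respect to the autocorrelation (AC) topology is a locally compact Abelian group.
   Context: Setting. $G$ is a $\sigma$-compact locally compact Abelian (Hausdorff) group, written additively, with Haar measure $\theta$. $\mathcal{A}=\{A_n\}$ is a fixed sequence of relatively compact open subsets with $A_1\neq\varnothing$, $\overline{A_n}\subset A_{n+1}$, $\bigcup_nA_n=G$. $S\subset G$ is countable, $w:S\to\mathbb{C}$, and $\omega=\sum_{x\in S}w(x)\delta_x$ is a complex regular Borel measure on $G$. Put $\Delta=S-S$ and $\eta_n(z)=\frac{1}{\theta(A_n)}\sum_{x,y\in S\cap A_n,\ x-y=z}w(x)\overline{w(y)}$ for $z\in\Delta$, $\eta_n(z)=0$ otherwise. Standing assumptions: (1) $\omega$ is translation bounded, i.e. $\sup_{t\in G}\sum_{x\in S\cap(t+K)}|w(x)|<\infty$ for every compact $K\subset G$. (2) $\eta(z)=\lim_n\eta_n(z)$ exists for all $z\in\Delta$ (so $\eta(z)=0$ for $z\notin\Delta$), and $\eta(0)>0$. (3) $\Delta$ is closed and discrete in $G$. (4) For every $\varepsilon>0$ the set $P_\varepsilon$ defined below is relatively dense in $G$ (there is a compact $K$ with $P_\varepsilon+K=G$). Notation: $\Delta^{\rm ess}=\{z\in G\mid\eta(z)\neq0\}$; $L=\langle\Delta^{\rm ess}\rangle_{\mathbb{Z}}$ is the subgroup of $G$ generated by $\Delta^{\rm ess}$; $\varrho(s,t)=|1-\eta(s-t)/\eta(0)|^{1/2}$, which is a translation invariant pseudo-metric on $G$ and on $L$; the topology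 it defines on $L$ is the AC topology; $P_\varepsilon=\{t\in G\mid\varrho(t,0)<\varepsilon\}$. *)

theory Defs
  imports
    "HOL-Analysis.Analysis"
    "HOL-Algebra.Coset"
    "HOL-Computational_Algebra.Group_Closure"
begin

section \<open>Measures on a locally compact Abelian group\<close>

definition sigma_compact :: "'a::topological_space set \<Rightarrow> bool" where
  "sigma_compact X \<longleftrightarrow> (\<exists>K :: nat \<Rightarrow> 'a set. (\<forall>n. compact (K n)) \<and> (\<Union>n. K n) = X)"

definition relatively_compact :: "'a::topological_space set \<Rightarrow> bool" where
  "relatively_compact B \<longleftrightarrow> compact (closure B)"

definition haar_measure :: "'a::topological_ab_group_add measure \<Rightarrow> bool" where
  "haar_measure \<theta> \<longleftrightarrow>
     sets \<theta> = sets borel \<and>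
     emeasure \<theta> UNIV \<noteq> 0 \<and>
     (\<forall>t. \<forall>B\<in>sets borel. emeasure \<theta> ((+) t ` B) = emeasure \<theta> B) \<and>
     (\<forall>K. compact K \<longrightarrow> emeasure \<theta> K < \<infinity>) \<and>
     (\<forall>B\<in>sets borel. emeasure \<theta> B = (INF U\<in>{U. open U \<and> B \<subseteq> U}. emeasure \<theta> U)) \<and>
     (\<forall>U. open U \<longrightarrow> emeasure \<theta> U = (SUP K\<in>{K. compact K \<and> K \<subseteq> U}. emeasure \<theta> K))"

text \<open>
  A complex regular Borel measure need not be finite on the whole group, so it is a set function
  whose values are only meaningful on relatively compact Borel sets. Regularity is stated for the
  total variation: the condition on all Borel subsets of \<open>U - K\<close> says, up to a constant factor,
  that the total variation of \<open>U - K\<close> is less than \<open>\<epsilon>\<close>.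
\<close>
definition complex_regular_borel_measure :: "('a::topological_space set \<Rightarrow> complex) \<Rightarrow> bool" where
  "complex_regular_borel_measure \<mu> \<longleftrightarrow>
     (\<forall>B :: nat \<Rightarrow> 'a set. range B \<subseteq> sets borel \<and> disjoint_family B \<and> relatively_compact (\<Union>i. B i)
        \<longrightarrow> (\<lambda>i. \<mu> (B i)) sums \<mu> (\<Union>i. B i)) \<and>
     (\<forall>B\<in>sets borel. relatively_compact B \<longrightarrow>
        (\<forall>\<epsilon>>0. \<exists>K U. compact K \<and> open U \<and> relatively_compact U \<and> K \<subseteq> B \<and> B \<subseteq> U \<and>
           (\<forall>C\<in>sets borel. C \<subseteq> U - K \<longrightarrow> norm (\<mu> C) < \<epsilon>)))"

text \<open>The identity \<open>\<omega> = (\<Sum>x\<in>S. w x \<delta>\<^sub>x)\<close>, with unconditional convergence of the sum.\<close>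
definition is_weighted_comb ::
    "('a::topological_space set \<Rightarrow> complex) \<Rightarrow> 'a set \<Rightarrow> ('a \<Rightarrow> complex) \<Rightarrow> bool" where
  "is_weighted_comb \<omega> S w \<longleftrightarrow>
     (\<forall>B\<in>sets borel. relatively_compact B \<longrightarrow> (w has_sum \<omega> B) (S \<inter> B))"

definition translation_bounded_comb ::
    "'a::topological_ab_group_add set \<Rightarrow> ('a \<Rightarrow> complex) \<Rightarrow> bool" where
  "translation_bounded_comb S w \<longleftrightarrow>
     (\<forall>K. compact K \<longrightarrow>
        (SUP t. \<Sum>\<^sub>\<infinity>x\<in>S \<inter> (+) t ` K. ennreal (norm (w x))) < \<infinity>)"


section \<open>The autocorrelation\<close>

definition difference_set :: "'a::ab_group_add set \<Rightarrow> 'a set" where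
  "difference_set S = {x - y | x y. x \<in> S \<and> y \<in> S}"

definition eta_approx ::
    "'a::topological_ab_group_add measure \<Rightarrow> (nat \<Rightarrow> 'a set) \<Rightarrow> 'a set \<Rightarrow> ('a \<Rightarrow> complex)
      \<Rightarrow> nat \<Rightarrow> 'a \<Rightarrow> complex" where
  "eta_approx \<theta> A S w n z =
     (if z \<in> difference_set S
      then of_real (1 / measure \<theta> (A n)) *
        (\<Sum>\<^sub>\<infinity>(x, y)\<in>{(x, y). x \<in> S \<inter> A n \<and> y \<in> S \<inter> A n \<and> x - y = z}. w x * cnj (w y))
      else 0)"

definition eta ::
    "'a::topological_ab_group_add measure \<Rightarrow> (nat \<Rightarrow> 'a set) \<Rightarrow> 'a set \<Rightarrow> ('a \<Rightarrow> complex)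
      \<Rightarrow> 'a \<Rightarrow> complex" where
  "eta \<theta> A S w z = lim (\<lambda>n. eta_approx \<theta> A S w n z)"

definition ac_dist :: "('a::ab_group_add \<Rightarrow> complex) \<Rightarrow> 'a \<Rightarrow> 'a \<Rightarrow> real" where
  "ac_dist \<eta> s t = sqrt (norm (1 - \<eta> (s - t) / \<eta> 0))"

definition almost_periods :: "('a::ab_group_add \<Rightarrow> complex) \<Rightarrow> real \<Rightarrow> 'a set" where
  "almost_periods \<eta> \<epsilon> = {t. ac_dist \<eta> t 0 < \<epsilon>}"

definition relatively_dense :: "'a::topological_ab_group_add set \<Rightarrow> bool" where
  "relatively_dense P \<longleftrightarrow> (\<exists>K. compact K \<and> {p + k | p k. p \<in> P \<and> k \<in> K} = UNIV)"

definition essential_differences :: "('a \<Rightarrow> complex) \<Rightarrow> 'a set" where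
  "essential_differences \<eta> = {z. \<eta> z \<noteq> 0}"

definition ac_group :: "('a::ab_group_add \<Rightarrow> complex) \<Rightarrow> 'a set" where
  "ac_group \<eta> = group_closure (essential_differences \<eta>)"

definition ac_topology :: "('a::ab_group_add \<Rightarrow> complex) \<Rightarrow> 'a topology" where
  "ac_topology \<eta> = topology (\<lambda>U. U \<subseteq> ac_group \<eta> \<and>
     (\<forall>x\<in>U. \<exists>\<epsilon>>0. {y \<in> ac_group \<eta>. ac_dist \<eta> x y < \<epsilon>} \<subseteq> U))"

lemma openin_ac_topology:
  "openin (ac_topology \<eta>) U \<longleftrightarrow> U \<subseteq> ac_group \<eta> \<and>
     (\<forall>x\<in>U. \<exists>\<epsilon>>0. {y \<in> ac_group \<eta>. ac_dist \<eta> x y < \<epsilon>} \<subseteq> U)"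
proof -
  have "istopology (\<lambda>U. U \<subseteq> ac_group \<eta> \<and>
     (\<forall>x\<in>U. \<exists>\<epsilon>>0. {y \<in> ac_group \<eta>. ac_dist \<eta> x y < \<epsilon>} \<subseteq> U))" (is "istopology ?P")
    unfolding istopology_def
  proof (intro conjI allI impI)
    fix U V assume UV: "?P U" "?P V"
    show "U \<inter> V \<subseteq> ac_group \<eta>" using UV by blast
    show "\<forall>x\<in>U \<inter> V. \<exists>\<epsilon>>0. {y \<in> ac_group \<eta>. ac_dist \<eta> x y < \<epsilon>} \<subseteq> U \<inter> V"
    proof
      fix x assume "x \<in> U \<inter> V"
      then obtain d e where "d > 0" "{y \<in> ac_group \<eta>. ac_dist \<eta> x y < d} \<subseteq> U"
        and "e > 0" "{y \<in> ac_group \<eta>. ac_dist \<eta> x y < e} \<subseteq> V"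
        using UV by (meson IntD1 IntD2)
      then show "\<exists>\<epsilon>>0. {y \<in> ac_group \<eta>. ac_dist \<eta> x y < \<epsilon>} \<subseteq> U \<inter> V"
        by (intro exI[of _ "min d e"]) auto
    qed
  next
    fix \<K> assume K: "\<forall>K\<in>\<K>. ?P K"
    show "\<Union>\<K> \<subseteq> ac_group \<eta>" using K by blast
    show "\<forall>x\<in>\<Union>\<K>. \<exists>\<epsilon>>0. {y \<in> ac_group \<eta>. ac_dist \<eta> x y < \<epsilon>} \<subseteq> \<Union>\<K>"
    proof
      fix x assume "x \<in> \<Union>\<K>"
      then obtain V where V: "V \<in> \<K>" "x \<in> V" by blast
      then obtain e where "e > 0" "{y \<in> ac_group \<eta>. ac_dist \<eta> x y < e} \<subseteq> V"
        using K by meson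
      then show "\<exists>\<epsilon>>0. {y \<in> ac_group \<eta>. ac_dist \<eta> x y < \<epsilon>} \<subseteq> \<Union>\<K>"
        using V(1) by (intro exI[of _ e]) blast
    qed
  qed
  then show ?thesis by (simp add: ac_topology_def)
qed

lemma topspace_ac_topology [simp]: "topspace (ac_topology \<eta>) = ac_group \<eta>"
proof
  show "topspace (ac_topology \<eta>) \<subseteq> ac_group \<eta>"
    unfolding topspace_def openin_ac_topology by blast
  have "openin (ac_topology \<eta>) (ac_group \<eta>)"
    unfolding openin_ac_topology by (auto intro: exI[of _ "1::real"])
  then show "ac_group \<eta> \<subseteq> topspace (ac_topology \<eta>)"
    by (rule openin_subset)
qed


section \<open>Hausdorff completion of a topological Abelian group\<close>

text \<open>
  In this section \<open>T\<close> is a first countable group topology on a subgroup \<open>topspace T\<close> of an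
  Abelian group. It need not be Hausdorff. First countability makes Cauchy sequences sufficient:
  the Hausdorff completion is the group of Cauchy sequences modulo the null sequences.
\<close>

definition cauchy_seqs :: "'a::ab_group_add topology \<Rightarrow> (nat \<Rightarrow> 'a) set" where
  "cauchy_seqs T = {s. range s \<subseteq> topspace T \<and>
     (\<forall>U. openin T U \<and> 0 \<in> U \<longrightarrow> (\<exists>N. \<forall>m\<ge>N. \<forall>n\<ge>N. s m - s n \<in> U))}"

definition null_seqs :: "'a::ab_group_add topology \<Rightarrow> (nat \<Rightarrow> 'a) set" where
  "null_seqs T = {s. range s \<subseteq> topspace T \<and> limitin T s 0 sequentially}"

definition cauchy_seq_group :: "'a::ab_group_add topology \<Rightarrow> (nat \<Rightarrow> 'a) monoid" where
  "cauchy_seq_group T =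
     \<lparr>carrier = cauchy_seqs T, mult = (\<lambda>s t n. s n + t n), one = (\<lambda>n. 0)\<rparr>"

definition completion_group :: "'a::ab_group_add topology \<Rightarrow> (nat \<Rightarrow> 'a) set monoid" where
  "completion_group T = cauchy_seq_group T Mod null_seqs T"

text \<open>
  Each open neighbourhood \<open>U\<close> of \<open>0\<close> in \<open>T\<close> induces the entourage of all pairs \<open>(X, Y)\<close> of classes
  having representatives whose difference is eventually in \<open>U\<close>. These entourages form a base of
  the uniformity of the completion, and the topology below is the one it defines.
\<close>

definition completion_nbhd ::
    "'a::ab_group_add topology \<Rightarrow> 'a set \<Rightarrow> (nat \<Rightarrow> 'a) set \<Rightarrow> (nat \<Rightarrow> 'a) set set" where
  "completion_nbhd T U X = {Y \<in> carrier (completion_group T).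
     \<exists>s\<in>X. \<exists>t\<in>Y. \<forall>\<^sub>F n in sequentially. t n - s n \<in> U}"

definition completion_topology :: "'a::ab_group_add topology \<Rightarrow> (nat \<Rightarrow> 'a) set topology" where
  "completion_topology T = topology (\<lambda>V. V \<subseteq> carrier (completion_group T) \<and>
     (\<forall>X\<in>V. \<exists>U. openin T U \<and> 0 \<in> U \<and> completion_nbhd T U X \<subseteq> V))"

lemma openin_completion_topology:
  "openin (completion_topology T) V \<longleftrightarrow> V \<subseteq> carrier (completion_group T) \<and>
     (\<forall>X\<in>V. \<exists>U. openin T U \<and> 0 \<in> U \<and> completion_nbhd T U X \<subseteq> V)"
proof -
  have mono: "completion_nbhd T (U \<inter> U') X \<subseteq> completion_nbhd T U X \<inter> completion_nbhd T U' X"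
    for U U' X
    unfolding completion_nbhd_def by (auto simp: eventually_conj_iff)
  have "istopology (\<lambda>V. V \<subseteq> carrier (completion_group T) \<and>
     (\<forall>X\<in>V. \<exists>U. openin T U \<and> 0 \<in> U \<and> completion_nbhd T U X \<subseteq> V))" (is "istopology ?P")
    unfolding istopology_def
  proof (intro conjI allI impI)
    fix V W assume VW: "?P V" "?P W"
    show "V \<inter> W \<subseteq> carrier (completion_group T)" using VW by blast
    show "\<forall>X\<in>V \<inter> W. \<exists>U. openin T U \<and> 0 \<in> U \<and> completion_nbhd T U X \<subseteq> V \<inter> W"
    proof
      fix X assume "X \<in> V \<inter> W"
      then obtain U U' where "openin T U" "0 \<in> U" "completion_nbhd T U X \<subseteq> V"
        and "openin T U'" "0 \<in> U'" "completion_nbhd T U' X \<subseteq> W"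
        using VW by (meson IntD1 IntD2)
      then show "\<exists>U. openin T U \<and> 0 \<in> U \<and> completion_nbhd T U X \<subseteq> V \<inter> W"
        using mono[of U U' X] by (intro exI[of _ "U \<inter> U'"]) (auto simp: openin_Int)
    qed
  next
    fix \<K> assume K: "\<forall>K\<in>\<K>. ?P K"
    show "\<Union>\<K> \<subseteq> carrier (completion_group T)" using K by blast
    show "\<forall>X\<in>\<Union>\<K>. \<exists>U. openin T U \<and> 0 \<in> U \<and> completion_nbhd T U X \<subseteq> \<Union>\<K>"
    proof
      fix X assume "X \<in> \<Union>\<K>"
      then obtain V where V: "V \<in> \<K>" "X \<in> V" by blast
      then obtain U where "openin T U" "0 \<in> U" "completion_nbhd T U X \<subseteq> V"
        using K by meson
      then show "\<exists>U. openin T U \<and> 0 \<in> U \<and> completion_nbhd T U X \<subseteq> \<Union>\<K>"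
        using V(1) by (intro exI[of _ U]) blast
    qed
  qed
  then show ?thesis by (simp add: completion_topology_def)
qed

definition locally_compact_abelian_group :: "('g, 'm) monoid_scheme \<Rightarrow> 'g topology \<Rightarrow> bool" where
  "locally_compact_abelian_group H T \<longleftrightarrow>
     comm_group H \<and> topspace T = carrier H \<and>
     continuous_map (prod_topology T T) T (\<lambda>(x, y). x \<otimes>\<^bsub>H\<^esub> y) \<and>
     continuous_map T T (\<lambda>x. inv\<^bsub>H\<^esub> x) \<and>
     Hausdorff_space T \<and> locally_compact_space T"

end

theory Submission
  imports Defs
begin

text \<open>
  Up to the factor \<open>1 / \<theta> (A\<^sub>n)\<close>, each \<open>\<eta>\<^sub>n\<close> is the autocorrelation of an absolutely summable
  function \<open>u\<close>, and then \<open>2 (\<eta>\<^sub>n 0 - Re (\<eta>\<^sub>n z))\<close> is the squared \<open>l\<^sup>2\<close> distance of \<open>u\<close> from its translate by \<open>z\<close>. Hence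
  \<open>N z = sqrt (1 - Re (\<eta> z) / \<eta> 0)\<close> is subadditive, and by Krein's inequality
  \<open>\<bar>\<eta> 0 - \<eta> z\<bar>\<^sup>2 \<le> 2 (\<eta> 0) (\<eta> 0 - Re (\<eta> z))\<close> it defines the AC topology. The completion is therefore
  a complete metric group, and it remains to find a totally bounded ball of \<open>N\<close> in \<open>L\<close>. If \<open>N x < 1/2\<close>
  and \<open>x = p + k\<close> with \<open>p\<close> an \<open>\<epsilon>\<close>-almost period and \<open>k\<close> in a fixed compact set \<open>K\<close>, then
  \<open>N k < 1\<close>, so \<open>\<eta> k \<noteq> 0\<close>, and only finitely many points of the closed discrete set \<open>\<Delta>\<close> lie in \<open>K\<close>.
\<close>

section \<open>Autocorrelations of summable functions\<close>

abbreviation norm_summable :: "('a \<Rightarrow> complex) \<Rightarrow> bool" where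
  "norm_summable f \<equiv> (\<lambda>x. norm (f x)) summable_on UNIV"

lemma infsum_of_real:
  fixes f :: "'a \<Rightarrow> real"
  assumes "f summable_on A"
  shows "(\<Sum>\<^sub>\<infinity>x\<in>A. complex_of_real (f x)) = complex_of_real (\<Sum>\<^sub>\<infinity>x\<in>A. f x)"
  by (intro infsumI has_sum_of_real has_sum_infsum assms)

lemma infsum_diff:
  fixes f g :: "'a \<Rightarrow> complex"
  assumes "f summable_on A" "g summable_on A"
  shows "(\<Sum>\<^sub>\<infinity>x\<in>A. f x - g x) = (\<Sum>\<^sub>\<infinity>x\<in>A. f x) - (\<Sum>\<^sub>\<infinity>x\<in>A. g x)"
  using infsum_add[OF assms(1), of "\<lambda>x. - g x"] assms(2)
  by (simp add: infsum_uminus summable_on_uminus)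

lemma norm_summable_bounded:
  assumes "norm_summable u"
  obtains M where "\<And>x. norm (u x) \<le> M"
proof
  fix x
  show "norm (u x) \<le> (\<Sum>\<^sub>\<infinity>x. norm (u x))"
    using finite_sum_le_infsum[of "\<lambda>x. norm (u x)" UNIV "{x}"] assms by simp
qed

text \<open>A summable \<open>g\<close> is bounded by some \<open>M\<close>, so the product is
  dominated by a constant multiple of \<open>f\<close>.\<close>

lemma norm_summable_mult_cnj:
  fixes f g :: "'a \<Rightarrow> complex"
  assumes "norm_summable f" "norm_summable g"
  shows "norm_summable (\<lambda>x. f x * cnj (g x))"
proof -
  obtain M where M: "\<And>x. norm (g x) \<le> M"
    using norm_summable_bounded[OF assms(2)] by blast
  show ?thesis
  proof (rule summable_on_comparison_test)
    show "norm_summable (\<lambda>x. of_real M * f x)"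
      using summable_on_cmult_right[OF assms(1), of "\<bar>M\<bar>"] by (simp add: norm_mult)
    show "norm (f x * cnj (g x)) \<le> norm (of_real M * f x)" for x
    proof -
      have "norm (f x) * norm (g x) \<le> norm (f x) * \<bar>M\<bar>"
        using M[of x] by (intro mult_left_mono) auto
      then show ?thesis by (simp add: norm_mult mult.commute)
    qed
  qed auto
qed

lemma summable_norm_square:
  fixes f :: "'a \<Rightarrow> complex"
  assumes "norm_summable f"
  shows "(\<lambda>x. (norm (f x))\<^sup>2) summable_on UNIV"
  using norm_summable_mult_cnj[OF assms assms] by (simp add: norm_mult power2_eq_square)

section \<open>The l2 norm, with the inequalities of Minkowski and Cauchy-Schwarz\<close>

definition l2_norm :: "('a \<Rightarrow> complex) \<Rightarrow> real" where
  "l2_norm f = sqrt (\<Sum>\<^sub>\<infinity>x. (norm (f x))\<^sup>2)"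

lemma l2_norm_nonneg: "0 \<le> l2_norm f"
  by (simp add: l2_norm_def infsum_nonneg)

lemma l2_norm_square: "(l2_norm f)\<^sup>2 = (\<Sum>\<^sub>\<infinity>x. (norm (f x))\<^sup>2)"
  by (simp add: l2_norm_def infsum_nonneg)

lemma L2_set_le_l2_norm:
  assumes "norm_summable f" "finite F"
  shows "L2_set (\<lambda>x. norm (f x)) F \<le> l2_norm f"
  unfolding L2_set_def l2_norm_def
  by (intro real_sqrt_le_mono finite_sum_le_infsum summable_norm_square assms) auto

lemma norm_summable_add:
  assumes "norm_summable f" "norm_summable g"
  shows "norm_summable (\<lambda>x. f x + g x)"
  using summable_on_add[OF assms]
  by (rule summable_on_comparison_test) (auto simp: norm_triangle_ineq)

text \<open>Minkowski's inequality: the finite version \<open>L2_set_triangle_ineq\<close> gives a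
  bound that does not depend on the finite set \<open>F\<close>, so it carries over to the infinite
  sum.\<close>

lemma l2_norm_triangle:
  assumes "norm_summable f" "norm_summable g"
  shows "l2_norm (\<lambda>x. f x + g x) \<le> l2_norm f + l2_norm g"
proof -
  have "(\<Sum>\<^sub>\<infinity>x. (norm (f x + g x))\<^sup>2) \<le> (l2_norm f + l2_norm g)\<^sup>2"
  proof (rule infsum_le_finite_sums)
    show "(\<lambda>x. (norm (f x + g x))\<^sup>2) summable_on UNIV"
      by (intro summable_norm_square norm_summable_add assms)
    fix F :: "'a set" assume F: "finite F"
    have "L2_set (\<lambda>x. norm (f x + g x)) F \<le> L2_set (\<lambda>x. norm (f x) + norm (g x)) F"
      by (intro L2_set_mono norm_triangle_ineq norm_ge_zero)
    also have "\<dots> \<le> L2_set (\<lambda>x. norm (f x)) F + L2_set (\<lambda>x. norm (g x)) F"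
      by (rule L2_set_triangle_ineq)
    also have "\<dots> \<le> l2_norm f + l2_norm g"
      by (intro add_mono L2_set_le_l2_norm assms F)
    finally have "(L2_set (\<lambda>x. norm (f x + g x)) F)\<^sup>2 \<le> (l2_norm f + l2_norm g)\<^sup>2"
      by (intro power_mono L2_set_nonneg)
    then show "(\<Sum>x\<in>F. (norm (f x + g x))\<^sup>2) \<le> (l2_norm f + l2_norm g)\<^sup>2"
      by (simp add: L2_set_def sum_nonneg)
  qed
  then show ?thesis
    unfolding l2_norm_def[of "\<lambda>x. f x + g x"]
    by (intro real_le_lsqrt add_nonneg_nonneg l2_norm_nonneg)
qed

text \<open>Cauchy-Schwarz, again obtained by bounding all finite partial sums uniformly.\<close>

lemma infsum_mult_cnj_le:
  assumes "norm_summable f" "norm_summable g"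
  shows "norm (\<Sum>\<^sub>\<infinity>x. f x * cnj (g x)) \<le> l2_norm f * l2_norm g"
proof -
  have "norm (\<Sum>\<^sub>\<infinity>x. f x * cnj (g x)) \<le> (\<Sum>\<^sub>\<infinity>x. norm (f x * cnj (g x)))"
    by (rule norm_infsum_bound[OF norm_summable_mult_cnj[OF assms]])
  also have "\<dots> \<le> l2_norm f * l2_norm g"
  proof (rule infsum_le_finite_sums[OF norm_summable_mult_cnj[OF assms]])
    fix F :: "'a set" assume F: "finite F"
    have "(\<Sum>x\<in>F. norm (f x * cnj (g x))) \<le> L2_set (\<lambda>x. norm (f x)) F * L2_set (\<lambda>x. norm (g x)) F"
      using L2_set_mult_ineq[of "\<lambda>x. norm (f x)" "\<lambda>x. norm (g x)" F] by (simp add: norm_mult)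
    also have "\<dots> \<le> l2_norm f * l2_norm g"
      by (intro mult_mono L2_set_le_l2_norm assms F L2_set_nonneg l2_norm_nonneg)
    finally show "(\<Sum>x\<in>F. norm (f x * cnj (g x))) \<le> l2_norm f * l2_norm g" .
  qed
  finally show ?thesis .
qed

section \<open>Inner products and l2 distances of the translates of a function\<close>

definition autocorrelation :: "('a::ab_group_add \<Rightarrow> complex) \<Rightarrow> 'a \<Rightarrow> complex" where
  "autocorrelation u z = (\<Sum>\<^sub>\<infinity>y. u (y + z) * cnj (u y))"

lemma norm_summable_translate:
  fixes u :: "'a::ab_group_add \<Rightarrow> complex"
  assumes "norm_summable u"
  shows "norm_summable (\<lambda>y. u (y + z))"
  using assms
    summable_on_reindex_bij_betw[of "\<lambda>y. y + z" UNIV UNIV "\<lambda>y. norm (u y)"]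
  by (simp add: bij_betw_def inj_on_def surj_plus_right)

lemma infsum_translate:
  fixes h :: "'a::ab_group_add \<Rightarrow> complex"
  shows "(\<Sum>\<^sub>\<infinity>y. h (y + z)) = (\<Sum>\<^sub>\<infinity>y. h y)"
  by (intro infsum_reindex_bij_betw) (simp add: bij_betw_def inj_on_def surj_plus_right)

text \<open>Summation over the group is translation invariant, so the inner product of two
  translates depends only on the difference of the shifts. Replacing \<open>y\<close> by
  \<open>y + t\<close> shows this.\<close>

lemma infsum_translate_mult_cnj:
  fixes u :: "'a::ab_group_add \<Rightarrow> complex"
  shows "(\<Sum>\<^sub>\<infinity>y. u (y + s) * cnj (u (y + t))) = autocorrelation u (s - t)"
proof -
  have "y + t + (s - t) = y + s" for y
    by simp
  then show ?thesis
    unfolding autocorrelation_def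
    using infsum_translate[of "\<lambda>y. u (y + (s - t)) * cnj (u y)" t] by simp
qed

lemma autocorrelation_minus: "autocorrelation u (- z) = cnj (autocorrelation u z)"
  using infsum_translate_mult_cnj[of u 0 z]
  unfolding autocorrelation_def infsum_cnj[symmetric] by (simp add: mult.commute)

context
  fixes u :: "'a::ab_group_add \<Rightarrow> complex"
  assumes u: "norm_summable u"
begin

lemma norm_summable_translate_diff:
  "norm_summable (\<lambda>y. u (y + s) - u (y + t))"
  using norm_summable_add[OF norm_summable_translate[OF u, of s], of "\<lambda>y. - u (y + t)"]
    norm_summable_translate[OF u, of t] by simp

text \<open>Expand the square: each translate has squared norm \<open>autocorrelation u 0\<close>,
  and the two cross terms are conjugates of each other, so they add up to twice a real part.\<close>

lemma l2_norm_translate_diff: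
  "(l2_norm (\<lambda>y. u (y + s) - u (y + t)))\<^sup>2 =
     2 * (Re (autocorrelation u 0) - Re (autocorrelation u (s - t)))"
proof -
  have *: "(\<lambda>y. u (y + s) * cnj (u (y + t))) summable_on UNIV" for s t
    by (rule abs_summable_summable[OF norm_summable_mult_cnj[OF norm_summable_translate[OF u] norm_summable_translate[OF u]]])
  \<comment> \<open>The cross terms are complex, so the expansion is done in the complex numbers and
    real parts are taken only at the end.\<close>
  have sq: "of_real ((norm (a - b))\<^sup>2) = (a * cnj a + b * cnj b) - (a * cnj b + b * cnj a)" for a b :: complex
    by (simp only: complex_norm_square) (simp add: algebra_simps)
  have "complex_of_real ((l2_norm (\<lambda>y. u (y + s) - u (y + t)))\<^sup>2) =
      (\<Sum>\<^sub>\<infinity>y. of_real ((norm (u (y + s) - u (y + t)))\<^sup>2))"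
    unfolding l2_norm_square
    by (rule infsum_of_real[symmetric, OF summable_norm_square[OF norm_summable_translate_diff]])
  also have "\<dots> = (\<Sum>\<^sub>\<infinity>y. u (y + s) * cnj (u (y + s))) + (\<Sum>\<^sub>\<infinity>y. u (y + t) * cnj (u (y + t)))
      - ((\<Sum>\<^sub>\<infinity>y. u (y + s) * cnj (u (y + t))) + (\<Sum>\<^sub>\<infinity>y. u (y + t) * cnj (u (y + s))))"
    unfolding sq
    unfolding infsum_diff[OF summable_on_add[OF * *] summable_on_add[OF * *]] infsum_add[OF * *] ..
  also have "\<dots> = autocorrelation u 0 + autocorrelation u 0 -
      (autocorrelation u (s - t) + cnj (autocorrelation u (s - t)))"
    unfolding infsum_translate_mult_cnj using autocorrelation_minus[of u "s - t"] by simp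
  finally have "Re (complex_of_real ((l2_norm (\<lambda>y. u (y + s) - u (y + t)))\<^sup>2)) =
    Re (autocorrelation u 0 + autocorrelation u 0 -
      (autocorrelation u (s - t) + cnj (autocorrelation u (s - t))))" by (rule arg_cong)
  then show ?thesis by simp
qed

lemma Re_autocorrelation_le: "Re (autocorrelation u z) \<le> Re (autocorrelation u 0)"
  using l2_norm_translate_diff[of z 0] zero_le_power2[of "l2_norm (\<lambda>y. u (y + z) - u (y + 0))"]
  by simp

text \<open>Up to the factor \<open>sqrt 2\<close>, each root is the l2 distance of \<open>u\<close>
  from one of its translates, so this is the triangle inequality of the l2 norm.\<close>

lemma autocorrelation_triangle:
  "sqrt (Re (autocorrelation u 0) - Re (autocorrelation u (s + t))) \<le>
     sqrt (Re (autocorrelation u 0) - Re (autocorrelation u s)) +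
     sqrt (Re (autocorrelation u 0) - Re (autocorrelation u t))"
proof -
  have sqrt_eq: "l2_norm (\<lambda>y. u (y + s) - u (y + t)) =
      sqrt 2 * sqrt (Re (autocorrelation u 0) - Re (autocorrelation u (s - t)))" for s t
    unfolding real_sqrt_mult[symmetric]
    by (rule real_sqrt_unique[symmetric, OF l2_norm_translate_diff l2_norm_nonneg])
  \<comment> \<open>The intermediate point is the translate by \<open>t\<close>. Its distance from
    the translate by \<open>s + t\<close> depends only on the difference \<open>s\<close>.\<close>
  have "l2_norm (\<lambda>y. u (y + (s + t)) - u (y + 0)) \<le>
     l2_norm (\<lambda>y. u (y + (s + t)) - u (y + t)) + l2_norm (\<lambda>y. u (y + t) - u (y + 0))"
    using l2_norm_triangle[OF norm_summable_translate_diff[of "s + t" t] norm_summable_translate_diff[of t 0]]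
    by simp
  then show ?thesis
    unfolding sqrt_eq distrib_left[symmetric] by simp
qed

text \<open>The left-hand difference is the inner product of \<open>u\<close> minus its translate
  with \<open>u\<close> itself. Cauchy-Schwarz and the formula for the distance of translates give
  the bound.\<close>

lemma autocorrelation_krein_inequality:
  "(norm (autocorrelation u 0 - autocorrelation u z))\<^sup>2 \<le>
     2 * Re (autocorrelation u 0) * (Re (autocorrelation u 0) - Re (autocorrelation u z))"
proof -
  have summ: "(\<lambda>y. u (y + s) * cnj (u (y + t))) summable_on UNIV" for s t
    by (rule abs_summable_summable[OF norm_summable_mult_cnj[OF norm_summable_translate[OF u] norm_summable_translate[OF u]]])
  have "complex_of_real ((l2_norm u)\<^sup>2) = autocorrelation u 0"
    unfolding l2_norm_square autocorrelation_def
    unfolding infsum_of_real[OF summable_norm_square[OF u], symmetric] complex_norm_square by simp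
  then have l2: "(l2_norm u)\<^sup>2 = Re (autocorrelation u 0)"
    using Re_complex_of_real by metis
  \<comment> \<open>Writing \<open>u y\<close> as \<open>u (y + 0)\<close> presents it as a
    translate, the form in which the lemmas on translates apply.\<close>
  have "autocorrelation u 0 - autocorrelation u z = (\<Sum>\<^sub>\<infinity>y. (u (y + 0) - u (y + z)) * cnj (u (y + 0)))"
    using summ[of 0 0] summ[of z 0]
    by (simp add: autocorrelation_def left_diff_distrib infsum_diff)
  also have "norm \<dots> \<le> l2_norm (\<lambda>y. u (y + 0) - u (y + z)) * l2_norm (\<lambda>y. u (y + 0))"
    by (intro infsum_mult_cnj_le norm_summable_translate_diff norm_summable_translate u)
  finally have "(norm (autocorrelation u 0 - autocorrelation u z))\<^sup>2 \<le>
      (l2_norm (\<lambda>y. u (y + 0) - u (y + z)) * l2_norm (\<lambda>y. u (y + 0)))\<^sup>2"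
    by (intro power_mono) auto
  also have "\<dots> = 2 * (Re (autocorrelation u 0) - Re (autocorrelation u (- z))) * (l2_norm u)\<^sup>2"
    using l2_norm_translate_diff[of 0 z] by (simp add: power_mult_distrib)
  finally show ?thesis
    by (simp add: autocorrelation_minus l2 algebra_simps)
qed

end

section \<open>Completion of a seminormed Abelian group\<close>

text \<open>The definition of \<open>mtotally_bounded\<close> asks for centres inside
  \<open>S\<close>; here they may lie anywhere. Halving the radius leaves room to move each centre
  to a point of \<open>S\<close>.\<close>

lemma (in Metric_space) mtotally_boundedI:
  assumes "S \<subseteq> M" and cover: "\<And>\<epsilon>. \<epsilon> > 0 \<Longrightarrow> \<exists>K. finite K \<and> S \<subseteq> (\<Union>x\<in>K. mball x \<epsilon>)"
  shows "mtotally_bounded S"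
  unfolding mtotally_bounded_def
proof (intro allI impI)
  fix \<epsilon> :: real assume "\<epsilon> > 0"
  then obtain K where K: "finite K" "S \<subseteq> (\<Union>x\<in>K. mball x (\<epsilon> / 2))"
    using cover[of "\<epsilon> / 2"] by auto
  \<comment> \<open>Only the centres whose ball meets \<open>S\<close> can be moved into
    \<open>S\<close>.\<close>
  define K' where "K' = {x \<in> K. mball x (\<epsilon> / 2) \<inter> S \<noteq> {}}"
  have "\<forall>x\<in>K'. \<exists>y. y \<in> mball x (\<epsilon> / 2) \<inter> S" by (auto simp: K'_def)
  then obtain f where f: "\<And>x. x \<in> K' \<Longrightarrow> f x \<in> mball x (\<epsilon> / 2) \<inter> S" by metis
  have "S \<subseteq> (\<Union>y\<in>f ` K'. mball y \<epsilon>)"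
  proof
    fix z assume z: "z \<in> S"
    then obtain x where x: "x \<in> K" "z \<in> mball x (\<epsilon> / 2)" using K(2) by blast
    then have "x \<in> K'" using z by (auto simp: K'_def)
    with f[of x] x triangle''[of "f x" x z] have "z \<in> mball (f x) \<epsilon>"
      by (auto simp: in_mball)
    with \<open>x \<in> K'\<close> show "z \<in> (\<Union>y\<in>f ` K'. mball y \<epsilon>)" by blast
  qed
  moreover have "finite (f ` K')" "f ` K' \<subseteq> S" using K(1) f by (auto simp: K'_def)
  ultimately show "\<exists>K. finite K \<and> K \<subseteq> S \<and> S \<subseteq> (\<Union>x\<in>K. mball x \<epsilon>)" by blast
qed

text \<open>The seminorm \<open>N\<close> is defined on the whole ambient group, which keeps its
  triangle inequality free of membership conditions. It may vanish away from 0, so \<open>T\<close>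
  may fail to be Hausdorff, and null sequences must be divided out.\<close>

locale seminormed_subgroup =
  fixes L :: "'a::ab_group_add set" and N :: "'a \<Rightarrow> real" and T :: "'a topology"
  assumes zero_mem: "0 \<in> L"
    and diff_mem: "x \<in> L \<Longrightarrow> y \<in> L \<Longrightarrow> x - y \<in> L"
    and N_zero: "N 0 = 0"
    and N_minus: "N (- x) = N x"
    and N_triangle: "N (x + y) \<le> N x + N y"
    and openin_iff: "openin T U \<longleftrightarrow> U \<subseteq> L \<and> (\<forall>x\<in>U. \<exists>\<epsilon>>0. {y \<in> L. N (y - x) < \<epsilon>} \<subseteq> U)"
begin

lemma uminus_mem: "x \<in> L \<Longrightarrow> - x \<in> L"
  using diff_mem[OF zero_mem] by simp

lemma add_mem: "x \<in> L \<Longrightarrow> y \<in> L \<Longrightarrow> x + y \<in> L"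
  using diff_mem[OF _ uminus_mem] by fastforce

lemma N_nonneg: "0 \<le> N x"
  using N_triangle[of x "- x"] by (simp add: N_zero N_minus)

lemma N_commute: "N (x - y) = N (y - x)"
  using N_minus[of "x - y"] by simp

lemma N_triangle_diff: "N (x - z) \<le> N (x - y) + N (y - z)"
  using N_triangle[of "x - y" "y - z"] by simp

lemma topspace_eq: "topspace T = L"
proof
  show "topspace T \<subseteq> L"
    unfolding topspace_def openin_iff by blast
  have "openin T L"
    unfolding openin_iff by (auto intro: exI[of _ "1::real"])
  then show "L \<subseteq> topspace T"
    by (rule openin_subset)
qed

lemma openin_N_ball: "openin T {y \<in> L. N (y - x) < \<epsilon>}"
  unfolding openin_iff
proof (intro conjI ballI)
  fix y assume "y \<in> {y \<in> L. N (y - x) < \<epsilon>}"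
  moreover have "N (z - x) < \<epsilon>" if "N (z - y) < \<epsilon> - N (y - x)" for z
    using N_triangle_diff[of z x y] that by simp
  ultimately show "\<exists>\<delta>>0. {z \<in> L. N (z - y) < \<delta>} \<subseteq> {y \<in> L. N (y - x) < \<epsilon>}"
    by (intro exI[of _ "\<epsilon> - N (y - x)"]) auto
qed auto

lemma openin_N_ball_zero: "\<epsilon> > 0 \<Longrightarrow> openin T {y \<in> L. N y < \<epsilon>} \<and> 0 \<in> {y \<in> L. N y < \<epsilon>}"
  using openin_N_ball[of 0 \<epsilon>] by (simp add: zero_mem N_zero)

section \<open>Cauchy and null sequences in terms of the seminorm\<close>

lemma nhd_contains_N_ball:
  assumes "openin T U" "0 \<in> U"
  obtains \<epsilon> where "\<epsilon> > 0" "\<And>y. y \<in> L \<Longrightarrow> N y < \<epsilon> \<Longrightarrow> y \<in> U"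
proof -
  from assms obtain \<epsilon> where "\<epsilon> > 0" and sub: "{y \<in> L. N (y - 0) < \<epsilon>} \<subseteq> U"
    unfolding openin_iff by meson
  show thesis
    using sub by (intro that[OF \<open>\<epsilon> > 0\<close>]) auto
qed

text \<open>The balls of \<open>N\<close> around 0 are open and form a neighbourhood base at 0, so
  testing on balls amounts to testing on all neighbourhoods.\<close>

lemma cauchy_seqs_iff:
  "s \<in> cauchy_seqs T \<longleftrightarrow>
     (\<forall>n. s n \<in> L) \<and> (\<forall>\<epsilon>>0. \<exists>M. \<forall>m\<ge>M. \<forall>n\<ge>M. N (s m - s n) < \<epsilon>)"
proof -
  have "(\<forall>U. openin T U \<and> 0 \<in> U \<longrightarrow> (\<exists>M. \<forall>m\<ge>M. \<forall>n\<ge>M. s m - s n \<in> U)) \<longleftrightarrow>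
     (\<forall>\<epsilon>>0. \<exists>M. \<forall>m\<ge>M. \<forall>n\<ge>M. N (s m - s n) < \<epsilon>)" if L: "\<forall>n. s n \<in> L"
  proof (intro iffI allI impI)
    fix \<epsilon> :: real
    assume *: "\<forall>U. openin T U \<and> 0 \<in> U \<longrightarrow> (\<exists>M. \<forall>m\<ge>M. \<forall>n\<ge>M. s m - s n \<in> U)" and "\<epsilon> > 0"
    from *[rule_format, OF openin_N_ball_zero[OF \<open>\<epsilon> > 0\<close>]]
    show "\<exists>M. \<forall>m\<ge>M. \<forall>n\<ge>M. N (s m - s n) < \<epsilon>"
      by auto
  next
    fix U
    assume *: "\<forall>\<epsilon>>0. \<exists>M. \<forall>m\<ge>M. \<forall>n\<ge>M. N (s m - s n) < \<epsilon>" and U: "openin T U \<and> 0 \<in> U"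
    obtain \<epsilon> where "\<epsilon> > 0" "\<And>y. y \<in> L \<Longrightarrow> N y < \<epsilon> \<Longrightarrow> y \<in> U"
      using nhd_contains_N_ball U by blast
    moreover from this * obtain M where "\<forall>m\<ge>M. \<forall>n\<ge>M. N (s m - s n) < \<epsilon>" by meson
    ultimately show "\<exists>M. \<forall>m\<ge>M. \<forall>n\<ge>M. s m - s n \<in> U"
      using L by (intro exI[of _ M]) (simp add: diff_mem)
  qed
  then show ?thesis
    unfolding cauchy_seqs_def topspace_eq by auto
qed

lemma null_seqs_iff:
  "s \<in> null_seqs T \<longleftrightarrow> (\<forall>n. s n \<in> L) \<and> (\<lambda>n. N (s n)) \<longlonglongrightarrow> 0"
proof -
  have "(\<forall>U. openin T U \<and> 0 \<in> U \<longrightarrow> (\<forall>\<^sub>F n in sequentially. s n \<in> U)) \<longleftrightarrow>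
      (\<forall>\<epsilon>>0. \<forall>\<^sub>F n in sequentially. N (s n) < \<epsilon>)" if L: "\<forall>n. s n \<in> L"
  proof (intro iffI allI impI)
    fix \<epsilon> :: real
    assume *: "\<forall>U. openin T U \<and> 0 \<in> U \<longrightarrow> (\<forall>\<^sub>F n in sequentially. s n \<in> U)" and "\<epsilon> > 0"
    from *[rule_format, OF openin_N_ball_zero[OF \<open>\<epsilon> > 0\<close>]]
    show "\<forall>\<^sub>F n in sequentially. N (s n) < \<epsilon>" by eventually_elim simp
  next
    fix U
    assume *: "\<forall>\<epsilon>>0. \<forall>\<^sub>F n in sequentially. N (s n) < \<epsilon>" and U: "openin T U \<and> 0 \<in> U"
    obtain \<epsilon> where \<epsilon>: "\<epsilon> > 0" "\<And>y. y \<in> L \<Longrightarrow> N y < \<epsilon> \<Longrightarrow> y \<in> U"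
      using nhd_contains_N_ball U by blast
    then have "\<forall>\<^sub>F n in sequentially. N (s n) < \<epsilon>" using * by blast
    then show "\<forall>\<^sub>F n in sequentially. s n \<in> U"
      by eventually_elim (use \<epsilon> L in blast)
  qed
  then show ?thesis
    unfolding null_seqs_def limitin_def topspace_eq
    by (auto simp: zero_mem tendsto_iff N_nonneg)
qed

lemma cauchy_seqs_mem: "s \<in> cauchy_seqs T \<Longrightarrow> s n \<in> L"
  by (simp add: cauchy_seqs_iff)

lemma const_cauchy_seqs: "x \<in> L \<Longrightarrow> (\<lambda>n. x) \<in> cauchy_seqs T"
  by (simp add: cauchy_seqs_iff N_zero)

lemma add_cauchy_seqs:
  assumes "s \<in> cauchy_seqs T" "t \<in> cauchy_seqs T"
  shows "(\<lambda>n. s n + t n) \<in> cauchy_seqs T"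
  unfolding cauchy_seqs_iff
proof (intro conjI allI impI)
  show "s n + t n \<in> L" for n
    using assms by (simp add: cauchy_seqs_mem add_mem)
next
  fix \<epsilon> :: real assume "\<epsilon> > 0"
  then have "\<epsilon> / 2 > 0" by simp
  then obtain M M' where M: "\<forall>m\<ge>M. \<forall>n\<ge>M. N (s m - s n) < \<epsilon> / 2"
      "\<forall>m\<ge>M'. \<forall>n\<ge>M'. N (t m - t n) < \<epsilon> / 2"
    using assms unfolding cauchy_seqs_iff by metis
  have "N (s m + t m - (s n + t n)) < \<epsilon>" if "m \<ge> max M M'" "n \<ge> max M M'" for m n
  proof -
    have "N (s m + t m - (s n + t n)) \<le> N (s m - s n) + N (t m - t n)"
      using N_triangle[of "s m - s n" "t m - t n"] by (simp add: algebra_simps)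
    also have "\<dots> < \<epsilon> / 2 + \<epsilon> / 2"
      using M that by (intro add_strict_mono) auto
    finally show ?thesis by simp
  qed
  then show "\<exists>K. \<forall>m\<ge>K. \<forall>n\<ge>K. N (s m + t m - (s n + t n)) < \<epsilon>" by blast
qed

lemma uminus_cauchy_seqs:
  assumes "s \<in> cauchy_seqs T"
  shows "(\<lambda>n. - s n) \<in> cauchy_seqs T"
proof -
  have "N (- x - - y) = N (x - y)" for x y
    using N_commute[of y x] by simp
  with assms show ?thesis
    by (simp add: cauchy_seqs_iff uminus_mem)
qed

lemma null_imp_cauchy_seqs:
  assumes "s \<in> null_seqs T"
  shows "s \<in> cauchy_seqs T"
  unfolding cauchy_seqs_iff
proof (intro conjI allI impI)
  show "s n \<in> L" for n using assms by (simp add: null_seqs_iff)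
next
  fix \<epsilon> :: real assume "\<epsilon> > 0"
  then have "\<forall>\<^sub>F n in sequentially. N (s n) < \<epsilon> / 2"
    using assms by (intro order_tendstoD(2)[of _ 0]) (auto simp: null_seqs_iff)
  then obtain M where M: "\<forall>n\<ge>M. N (s n) < \<epsilon> / 2"
    by (auto simp: eventually_sequentially)
  have "N (s m - s n) < \<epsilon>" if "m \<ge> M" "n \<ge> M" for m n
  proof -
    have "N (s m - s n) \<le> N (s m) + N (s n)"
      using N_triangle[of "s m" "- s n"] by (simp add: N_minus)
    also have "\<dots> < \<epsilon> / 2 + \<epsilon> / 2"
      using M that by (intro add_strict_mono) auto
    finally show ?thesis by simp
  qed
  then show "\<exists>M. \<forall>m\<ge>M. \<forall>n\<ge>M. N (s m - s n) < \<epsilon>" by blast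
qed

section \<open>The group of Cauchy sequences modulo null sequences\<close>

lemma comm_group_cauchy_seq_group: "comm_group (cauchy_seq_group T)"
proof (rule comm_groupI)
  show "\<exists>t\<in>carrier (cauchy_seq_group T). t \<otimes>\<^bsub>cauchy_seq_group T\<^esub> s = \<one>\<^bsub>cauchy_seq_group T\<^esub>"
    if "s \<in> carrier (cauchy_seq_group T)" for s
    using that
    by (intro bexI[of _ "\<lambda>n. - s n"]) (auto simp: cauchy_seq_group_def uminus_cauchy_seqs)
qed (auto simp: cauchy_seq_group_def const_cauchy_seqs add_cauchy_seqs zero_mem algebra_simps)

lemma inv_cauchy_seq_group:
  assumes "s \<in> cauchy_seqs T"
  shows "inv\<^bsub>cauchy_seq_group T\<^esub> s = (\<lambda>n. - s n)"
proof -
  interpret G: comm_group "cauchy_seq_group T" by (rule comm_group_cauchy_seq_group)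
  show ?thesis
    using assms by (intro G.inv_equality) (auto simp: cauchy_seq_group_def uminus_cauchy_seqs)
qed

lemma subgroup_null_seqs: "subgroup (null_seqs T) (cauchy_seq_group T)"
proof
  show "null_seqs T \<subseteq> carrier (cauchy_seq_group T)"
    by (auto simp: cauchy_seq_group_def null_imp_cauchy_seqs)
  show "\<one>\<^bsub>cauchy_seq_group T\<^esub> \<in> null_seqs T"
    by (simp add: cauchy_seq_group_def null_seqs_iff zero_mem N_zero)
  show "inv\<^bsub>cauchy_seq_group T\<^esub> s \<in> null_seqs T" if "s \<in> null_seqs T" for s
    using that
    by (simp add: inv_cauchy_seq_group null_imp_cauchy_seqs) (simp add: null_seqs_iff uminus_mem N_minus)
  show "s \<otimes>\<^bsub>cauchy_seq_group T\<^esub> t \<in> null_seqs T" if st: "s \<in> null_seqs T" "t \<in> null_seqs T" for s t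
  proof -
    have "(\<lambda>n. N (s n) + N (t n)) \<longlonglongrightarrow> 0 + 0"
      using st by (intro tendsto_add) (auto simp: null_seqs_iff)
    then have "(\<lambda>n. N (s n) + N (t n)) \<longlonglongrightarrow> 0" by simp
    then have "(\<lambda>n. N (s n + t n)) \<longlonglongrightarrow> 0"
      by (rule Lim_null_comparison[OF always_eventually, rotated])
        (simp add: N_triangle abs_of_nonneg[OF N_nonneg])
    with st show ?thesis
      by (simp add: cauchy_seq_group_def null_seqs_iff add_mem)
  qed
qed

lemma normal_null_seqs: "null_seqs T \<lhd> cauchy_seq_group T"
  by (rule comm_group.subgroup_imp_normal[OF comm_group_cauchy_seq_group subgroup_null_seqs])

lemma comm_group_completion: "comm_group (completion_group T)"
  unfolding completion_group_def
  by (rule comm_group.abelian_FactGroup[OF comm_group_cauchy_seq_group subgroup_null_seqs])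

definition cls :: "(nat \<Rightarrow> 'a) \<Rightarrow> (nat \<Rightarrow> 'a) set" where
  "cls s = null_seqs T #>\<^bsub>cauchy_seq_group T\<^esub> s"

lemma mem_cls_iff:
  assumes "s \<in> cauchy_seqs T"
  shows "t \<in> cls s \<longleftrightarrow> t \<in> cauchy_seqs T \<and> (\<lambda>n. N (t n - s n)) \<longlonglongrightarrow> 0"
proof
  assume "t \<in> cls s"
  then obtain h where h: "h \<in> null_seqs T" "t = (\<lambda>n. h n + s n)"
    by (auto simp: cls_def r_coset_def cauchy_seq_group_def)
  then show "t \<in> cauchy_seqs T \<and> (\<lambda>n. N (t n - s n)) \<longlonglongrightarrow> 0"
    using assms by (auto simp: add_cauchy_seqs null_imp_cauchy_seqs) (simp add: null_seqs_iff)
next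
  assume t: "t \<in> cauchy_seqs T \<and> (\<lambda>n. N (t n - s n)) \<longlonglongrightarrow> 0"
  then have "(\<lambda>n. t n - s n) \<in> null_seqs T"
    using assms by (simp add: null_seqs_iff diff_mem cauchy_seqs_mem)
  moreover have "t = (\<lambda>n. (t n - s n) + s n)" by simp
  ultimately show "t \<in> cls s"
    unfolding cls_def r_coset_def cauchy_seq_group_def by fastforce
qed

lemma self_mem_cls: "s \<in> cauchy_seqs T \<Longrightarrow> s \<in> cls s"
  by (simp add: mem_cls_iff N_zero)

lemma carrier_completion: "carrier (completion_group T) = cls ` cauchy_seqs T"
  by (auto simp: completion_group_def FactGroup_def RCOSETS_def cls_def cauchy_seq_group_def)

lemma cls_mem_carrier: "s \<in> cauchy_seqs T \<Longrightarrow> cls s \<in> carrier (completion_group T)"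
  by (simp add: carrier_completion)

lemma mult_cls:
  assumes "s \<in> cauchy_seqs T" "t \<in> cauchy_seqs T"
  shows "cls s \<otimes>\<^bsub>completion_group T\<^esub> cls t = cls (\<lambda>n. s n + t n)"
  using normal.rcos_sum[OF normal_null_seqs, of s t] assms
  by (simp add: completion_group_def cls_def cauchy_seq_group_def)

lemma inv_cls:
  assumes "s \<in> cauchy_seqs T"
  shows "inv\<^bsub>completion_group T\<^esub> cls s = cls (\<lambda>n. - s n)"
proof -
  have "cls s \<in> carrier (cauchy_seq_group T Mod null_seqs T)"
    using cls_mem_carrier[OF assms] by (simp add: completion_group_def)
  from normal.inv_FactGroup[OF normal_null_seqs this] show ?thesis
    using normal.rcos_inv[OF normal_null_seqs, of s] assms
    by (simp add: completion_group_def cls_def inv_cauchy_seq_group) (simp add: cauchy_seq_group_def)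
qed

section \<open>The metric of the completion\<close>

lemma convergent_N_diff:
  assumes "s \<in> cauchy_seqs T" "t \<in> cauchy_seqs T"
  shows "convergent (\<lambda>n. N (s n - t n))"
proof -
  have "Cauchy (\<lambda>n. N (s n - t n))"
  proof (rule metric_CauchyI)
    fix \<epsilon> :: real assume "\<epsilon> > 0"
    then have "\<epsilon> / 2 > 0" by simp
    then obtain M M' where M: "\<forall>m\<ge>M. \<forall>n\<ge>M. N (s m - s n) < \<epsilon> / 2"
        "\<forall>m\<ge>M'. \<forall>n\<ge>M'. N (t m - t n) < \<epsilon> / 2"
      using assms unfolding cauchy_seqs_iff by metis
    \<comment> \<open>This one-sided bound is applied twice, the second time with \<open>m\<close>
      and \<open>n\<close> exchanged, to control the absolute value.\<close>
    have *: "N (s m - t m) < N (s n - t n) + \<epsilon>" if "m \<ge> max M M'" "n \<ge> max M M'" for m n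
    proof -
      have "N (s m - t m) \<le> N (s m - s n) + N (s n - t n) + N (t n - t m)"
        using N_triangle_diff[of "s m" "t m" "s n"] N_triangle_diff[of "s n" "t m" "t n"] by simp
      also have "N (s m - s n) < \<epsilon> / 2" using M that by auto
      also have "N (t n - t m) < \<epsilon> / 2" using M that by auto
      finally show ?thesis by simp
    qed
    have "dist (N (s m - t m)) (N (s n - t n)) < \<epsilon>" if "m \<ge> max M M'" "n \<ge> max M M'" for m n
      using *[OF that] *[OF that(2,1)] by (simp add: dist_real_def)
    then show "\<exists>K. \<forall>m\<ge>K. \<forall>n\<ge>K. dist (N (s m - t m)) (N (s n - t n)) < \<epsilon>" by blast
  qed
  then show ?thesis by (rule Cauchy_convergent)
qed

text \<open>Representatives are picked by choice; \<open>tendsto_D\<close> shows that the limit does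
  not depend on them. The value 0 off the carrier makes nonnegativity and symmetry hold for all
  arguments, as \<open>Metric_space\<close> demands.\<close>

definition D :: "(nat \<Rightarrow> 'a) set \<Rightarrow> (nat \<Rightarrow> 'a) set \<Rightarrow> real" where
  "D X Y = (if X \<in> carrier (completion_group T) \<and> Y \<in> carrier (completion_group T)
     then lim (\<lambda>n. N ((SOME s. s \<in> X) n - (SOME t. t \<in> Y) n)) else 0)"

text \<open>By the triangle inequality, passing to the chosen representatives changes the distances
  by at most the sum of two null sequences.\<close>

lemma tendsto_D:
  assumes "s \<in> cauchy_seqs T" "t \<in> cauchy_seqs T"
  shows "(\<lambda>n. N (s n - t n)) \<longlonglongrightarrow> D (cls s) (cls t)"
proof -
  define s' t' where "s' = (SOME x. x \<in> cls s)" and "t' = (SOME x. x \<in> cls t)"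
  have "s' \<in> cls s" "t' \<in> cls t"
    unfolding s'_def t'_def using self_mem_cls assms by (metis someI)+
  then have st: "s' \<in> cauchy_seqs T" "(\<lambda>n. N (s' n - s n)) \<longlonglongrightarrow> 0"
      "t' \<in> cauchy_seqs T" "(\<lambda>n. N (t' n - t n)) \<longlonglongrightarrow> 0"
    using assms by (auto simp: mem_cls_iff)
  have lim: "(\<lambda>n. N (s' n - t' n)) \<longlonglongrightarrow> D (cls s) (cls t)"
    using convergent_N_diff[OF st(1,3)]
    by (simp add: D_def assms cls_mem_carrier s'_def t'_def convergent_LIMSEQ_iff)
  have *: "(\<lambda>n. N (s' n - s n) + N (t' n - t n)) \<longlonglongrightarrow> 0"
    using tendsto_add[OF st(2,4)] by simp
  have "\<bar>N (s n - t n) - N (s' n - t' n)\<bar> \<le> N (s' n - s n) + N (t' n - t n)" for n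
    using N_triangle_diff[of "s n" "t n" "s' n"] N_triangle_diff[of "s' n" "t n" "t' n"]
      N_triangle_diff[of "s' n" "t' n" "s n"] N_triangle_diff[of "s n" "t' n" "t n"]
      N_commute[of "s n" "s' n"] N_commute[of "t n" "t' n"] by linarith
  then have "(\<lambda>n. N (s n - t n) - N (s' n - t' n)) \<longlonglongrightarrow> 0"
    by (intro Lim_null_comparison[OF _ *]) simp
  from tendsto_add[OF this lim] show ?thesis by simp
qed

lemma D_eqI:
  assumes "s \<in> cauchy_seqs T" "t \<in> cauchy_seqs T" "(\<lambda>n. N (s n - t n)) \<longlonglongrightarrow> l"
  shows "D (cls s) (cls t) = l"
  using tendsto_D[OF assms(1,2)] assms(3) LIMSEQ_unique by blast

lemma D_commute_cls:
  assumes "s \<in> cauchy_seqs T" "t \<in> cauchy_seqs T"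
  shows "D (cls s) (cls t) = D (cls t) (cls s)"
  using D_eqI[OF assms, of "D (cls t) (cls s)"] tendsto_D[OF assms(2,1)] by (simp add: N_commute)


lemma D_triangle_cls:
  assumes "s \<in> cauchy_seqs T" "t \<in> cauchy_seqs T" "r \<in> cauchy_seqs T"
  shows "D (cls s) (cls r) \<le> D (cls s) (cls t) + D (cls t) (cls r)"
  using N_triangle_diff
  by (intro tendsto_le[OF _ tendsto_add[OF tendsto_D[OF assms(1,2)] tendsto_D[OF assms(2,3)]]
        tendsto_D[OF assms(1,3)]]) auto

lemma D_eq_zero_iff_cls:
  assumes "s \<in> cauchy_seqs T" "t \<in> cauchy_seqs T"
  shows "D (cls s) (cls t) = 0 \<longleftrightarrow> cls s = cls t"
proof
  assume "D (cls s) (cls t) = 0"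
  then have 0: "(\<lambda>n. N (s n - t n)) \<longlonglongrightarrow> 0" using tendsto_D[OF assms] by simp
  \<comment> \<open>Stated for arbitrary sequences so that it yields both inclusions.\<close>
  have "cls s' \<subseteq> cls t'"
    if s't': "s' \<in> cauchy_seqs T" "t' \<in> cauchy_seqs T" and lim: "(\<lambda>n. N (s' n - t' n)) \<longlonglongrightarrow> 0" for s' t'
  proof
    fix r assume "r \<in> cls s'"
    then have r: "r \<in> cauchy_seqs T" "(\<lambda>n. N (r n - s' n)) \<longlonglongrightarrow> 0"
      using s't' by (auto simp: mem_cls_iff)
    from tendsto_add[OF r(2) lim]
    have *: "(\<lambda>n. N (r n - s' n) + N (s' n - t' n)) \<longlonglongrightarrow> 0" by simp
    have "(\<lambda>n. N (r n - t' n)) \<longlonglongrightarrow> 0"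
      by (rule Lim_null_comparison[OF _ *]) (simp add: N_triangle_diff abs_of_nonneg[OF N_nonneg])
    with r s't' show "r \<in> cls t'" by (simp add: mem_cls_iff)
  qed
  then show "cls s = cls t"
    using assms 0 by (intro subset_antisym) (simp_all add: N_commute)
next
  assume "cls s = cls t"
  moreover have "D (cls s) (cls s) = 0"
    using assms by (intro D_eqI) (auto simp: N_zero)
  ultimately show "D (cls s) (cls t) = 0" by simp
qed

sublocale H: Metric_space "carrier (completion_group T)" D
proof
  show "0 \<le> D X Y" for X Y
  proof (cases "X \<in> carrier (completion_group T) \<and> Y \<in> carrier (completion_group T)")
    case True
    then obtain s t where st: "s \<in> cauchy_seqs T" "t \<in> cauchy_seqs T" "X = cls s" "Y = cls t"
      by (auto simp: carrier_completion)
    show ?thesis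
      using LIMSEQ_le_const[OF tendsto_D[OF st(1,2)]] st by (auto simp: N_nonneg)
  qed (auto simp: D_def)
  show "D X Y = D Y X" for X Y
  proof (cases "X \<in> carrier (completion_group T) \<and> Y \<in> carrier (completion_group T)")
    case True
    then show ?thesis
      using D_commute_cls by (auto simp: carrier_completion)
  qed (auto simp: D_def)
  show "D X Y = 0 \<longleftrightarrow> X = Y"
    if "X \<in> carrier (completion_group T)" "Y \<in> carrier (completion_group T)" for X Y
    using that D_eq_zero_iff_cls by (auto simp: carrier_completion)
  show "D X Z \<le> D X Y + D Y Z"
    if "X \<in> carrier (completion_group T)" "Y \<in> carrier (completion_group T)"
      "Z \<in> carrier (completion_group T)" for X Y Z
    using that D_triangle_cls by (auto simp: carrier_completion)
qed

section \<open>Agreement of the entourage topology with the metric topology\<close>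

lemma completion_nbhd_cls:
  assumes "s \<in> cauchy_seqs T" "\<epsilon> > 0"
  shows "completion_nbhd T {y \<in> L. N y < \<epsilon> / 2} (cls s) \<subseteq> H.mball (cls s) \<epsilon>"
proof
  fix Y assume "Y \<in> completion_nbhd T {y \<in> L. N y < \<epsilon> / 2} (cls s)"
  then obtain s' t where Y: "Y \<in> carrier (completion_group T)" "s' \<in> cls s" "t \<in> Y"
      "\<forall>\<^sub>F n in sequentially. t n - s' n \<in> {y \<in> L. N y < \<epsilon> / 2}"
    by (auto simp: completion_nbhd_def)
  then obtain t' where t': "t' \<in> cauchy_seqs T" "Y = cls t'" by (auto simp: carrier_completion)
  have s': "s' \<in> cauchy_seqs T" and t: "t \<in> cauchy_seqs T"
    using Y t' assms by (auto simp: mem_cls_iff)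
  \<comment> \<open>The representatives that witness the neighbourhood need not be the given ones,
    so it is checked that they determine the same classes.\<close>
  have "cls s' = cls s"
    using D_eq_zero_iff_cls[OF s' assms(1)] D_eqI[OF s' assms(1), of 0] Y(2) assms
    by (simp add: mem_cls_iff)
  moreover have "cls t = cls t'"
    using D_eq_zero_iff_cls[OF t t'(1)] D_eqI[OF t t'(1), of 0] Y(3) t'
    by (simp add: mem_cls_iff)
  \<comment> \<open>Passing to the limit weakens a strict bound to a weak one. The halved radius
    still leaves \<open>D\<close> strictly below \<open>\<epsilon>\<close>.\<close>
  moreover have "D (cls s') (cls t) \<le> \<epsilon> / 2"
  proof (rule tendsto_upperbound[OF tendsto_D[OF s' t]])
    show "\<forall>\<^sub>F n in sequentially. N (s' n - t n) \<le> \<epsilon> / 2"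
      using Y(4) by eventually_elim (simp add: N_commute)
  qed simp
  ultimately show "Y \<in> H.mball (cls s) \<epsilon>"
    using \<open>\<epsilon> > 0\<close> assms t' by (simp add: H.in_mball cls_mem_carrier)
qed

text \<open>A limit strictly below \<open>\<epsilon>\<close> forces the terms to be eventually below
  \<open>\<epsilon>\<close>, so here the radius is kept.\<close>

lemma mball_subset_completion_nbhd:
  assumes "s \<in> cauchy_seqs T" and U: "\<And>y. y \<in> L \<Longrightarrow> N y < \<epsilon> \<Longrightarrow> y \<in> U"
  shows "H.mball (cls s) \<epsilon> \<subseteq> completion_nbhd T U (cls s)"
proof
  fix Y assume "Y \<in> H.mball (cls s) \<epsilon>"
  then obtain t where t: "t \<in> cauchy_seqs T" "Y = cls t" "D (cls s) (cls t) < \<epsilon>"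
    unfolding H.in_mball by (auto simp: carrier_completion)
  have "\<forall>\<^sub>F n in sequentially. N (s n - t n) < \<epsilon>"
    by (rule order_tendstoD(2)[OF tendsto_D[OF assms(1) t(1)] t(3)])
  then have "\<forall>\<^sub>F n in sequentially. t n - s n \<in> U"
    by eventually_elim (use U assms t in \<open>simp add: N_commute diff_mem cauchy_seqs_mem\<close>)
  then show "Y \<in> completion_nbhd T U (cls s)"
    using t assms self_mem_cls by (auto simp: completion_nbhd_def cls_mem_carrier)
qed

lemma completion_topology_eq: "completion_topology T = H.mtopology"
proof -
  have "(\<exists>U. openin T U \<and> 0 \<in> U \<and> completion_nbhd T U X \<subseteq> V) \<longleftrightarrow> (\<exists>\<epsilon>>0. H.mball X \<epsilon> \<subseteq> V)"
    if X: "X \<in> carrier (completion_group T)" for X V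
  proof -
    obtain s where s: "s \<in> cauchy_seqs T" "X = cls s"
      using X by (auto simp: carrier_completion)
    show ?thesis
    proof (intro iffI; elim exE conjE)
      fix U assume U: "openin T U" "0 \<in> U" "completion_nbhd T U X \<subseteq> V"
      obtain \<epsilon> where \<epsilon>: "\<epsilon> > 0" "\<And>y. y \<in> L \<Longrightarrow> N y < \<epsilon> \<Longrightarrow> y \<in> U"
        using nhd_contains_N_ball U(1,2) by blast
      have "H.mball X \<epsilon> \<subseteq> completion_nbhd T U X"
        unfolding s(2) by (rule mball_subset_completion_nbhd[OF s(1) \<epsilon>(2)])
      then show "\<exists>\<epsilon>>0. H.mball X \<epsilon> \<subseteq> V"
        using \<epsilon>(1) U(3) by blast
    next
      fix \<epsilon> :: real assume \<epsilon>: "\<epsilon> > 0" "H.mball X \<epsilon> \<subseteq> V"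
      then show "\<exists>U. openin T U \<and> 0 \<in> U \<and> completion_nbhd T U X \<subseteq> V"
        using openin_N_ball_zero[of "\<epsilon> / 2"] completion_nbhd_cls[OF s(1) \<epsilon>(1)] s(2)
        by (intro exI[of _ "{y \<in> L. N y < \<epsilon> / 2}"]) auto
    qed
  qed
  then show ?thesis
    unfolding topology_eq openin_completion_topology H.openin_mtopology by blast
qed

section \<open>Continuity of the group operations\<close>

lemma D_mult_le:
  assumes "X \<in> carrier (completion_group T)" "Y \<in> carrier (completion_group T)"
    "X' \<in> carrier (completion_group T)" "Y' \<in> carrier (completion_group T)"
  shows "D (X \<otimes>\<^bsub>completion_group T\<^esub> Y) (X' \<otimes>\<^bsub>completion_group T\<^esub> Y') \<le> D X X' + D Y Y'"
proof -
  obtain s t s' t' where st: "s \<in> cauchy_seqs T" "t \<in> cauchy_seqs T" "X = cls s" "Y = cls t"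
    "s' \<in> cauchy_seqs T" "t' \<in> cauchy_seqs T" "X' = cls s'" "Y' = cls t'"
    using assms by (auto simp: carrier_completion)
  have "N (s n + t n - (s' n + t' n)) \<le> N (s n - s' n) + N (t n - t' n)" for n
    using N_triangle[of "s n - s' n" "t n - t' n"] by (simp add: algebra_simps)
  then have "D (cls (\<lambda>n. s n + t n)) (cls (\<lambda>n. s' n + t' n)) \<le> D (cls s) (cls s') + D (cls t) (cls t')"
    using st by (intro tendsto_le[OF _ tendsto_add[OF tendsto_D tendsto_D] tendsto_D])
      (auto simp: add_cauchy_seqs)
  then show ?thesis by (simp add: st mult_cls)
qed

lemma D_inv:
  assumes "X \<in> carrier (completion_group T)" "Y \<in> carrier (completion_group T)"
  shows "D (inv\<^bsub>completion_group T\<^esub> X) (inv\<^bsub>completion_group T\<^esub> Y) = D X Y"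
proof -
  obtain s t where st: "s \<in> cauchy_seqs T" "t \<in> cauchy_seqs T" "X = cls s" "Y = cls t"
    using assms by (auto simp: carrier_completion)
  have "(\<lambda>n. N (- s n - - t n)) \<longlonglongrightarrow> D (cls s) (cls t)"
    using tendsto_D[OF st(1,2)] by (simp add: N_commute)
  then show ?thesis
    using st by (simp add: inv_cls D_eqI uminus_cauchy_seqs)
qed

lemma continuous_map_mult:
  "continuous_map (prod_topology H.mtopology H.mtopology) H.mtopology
     (\<lambda>(X, Y). X \<otimes>\<^bsub>completion_group T\<^esub> Y)"
proof -
  interpret C: comm_group "completion_group T" by (rule comm_group_completion)
  show ?thesis
    unfolding H.continuous_map_to_metric topspace_prod_topology H.topspace_mtopology
  proof (intro ballI allI impI)
    fix Z and \<epsilon> :: real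
    assume "Z \<in> carrier (completion_group T) \<times> carrier (completion_group T)" "\<epsilon> > 0"
    then obtain X Y where XY: "Z = (X, Y)" "X \<in> carrier (completion_group T)"
        "Y \<in> carrier (completion_group T)" by auto
    have "openin (prod_topology H.mtopology H.mtopology) (H.mball X (\<epsilon> / 2) \<times> H.mball Y (\<epsilon> / 2))"
      by (simp add: openin_prod_Times_iff)
    moreover have "X' \<otimes>\<^bsub>completion_group T\<^esub> Y' \<in> H.mball (X \<otimes>\<^bsub>completion_group T\<^esub> Y) \<epsilon>"
      if "X' \<in> H.mball X (\<epsilon> / 2)" "Y' \<in> H.mball Y (\<epsilon> / 2)" for X' Y'
      using D_mult_le[of X Y X' Y'] that XY by (auto simp: H.in_mball)
    ultimately show "\<exists>U. openin (prod_topology H.mtopology H.mtopology) U \<and> Z \<in> U \<and>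
       (\<forall>Z'\<in>U. (case Z' of (X, Y) \<Rightarrow> X \<otimes>\<^bsub>completion_group T\<^esub> Y)
          \<in> H.mball (case Z of (X, Y) \<Rightarrow> X \<otimes>\<^bsub>completion_group T\<^esub> Y) \<epsilon>)"
      using XY \<open>\<epsilon> > 0\<close>
      by (intro exI[of _ "H.mball X (\<epsilon> / 2) \<times> H.mball Y (\<epsilon> / 2)"]) auto
  qed
qed

lemma continuous_map_inv:
  "continuous_map H.mtopology H.mtopology (\<lambda>X. inv\<^bsub>completion_group T\<^esub> X)"
proof -
  interpret C: comm_group "completion_group T" by (rule comm_group_completion)
  show ?thesis
    unfolding H.continuous_map_to_metric H.topspace_mtopology
  proof (intro ballI allI impI)
    fix X and \<epsilon> :: real
    assume "X \<in> carrier (completion_group T)" "\<epsilon> > 0"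
    then show "\<exists>U. openin H.mtopology U \<and> X \<in> U \<and>
       (\<forall>Y\<in>U. inv\<^bsub>completion_group T\<^esub> Y \<in> H.mball (inv\<^bsub>completion_group T\<^esub> X) \<epsilon>)"
      by (intro exI[of _ "H.mball X \<epsilon>"]) (auto simp: H.in_mball D_inv)
  qed
qed

section \<open>Density of the constant sequences, and completeness\<close>

lemma D_const:
  assumes "x \<in> L" "y \<in> L"
  shows "D (cls (\<lambda>n. x)) (cls (\<lambda>n. y)) = N (x - y)"
  using assms by (intro D_eqI) (auto simp: const_cauchy_seqs)

lemma D_const_le:
  assumes "x \<in> L" "s \<in> cauchy_seqs T" "\<And>n. n \<ge> M \<Longrightarrow> N (x - s n) \<le> \<epsilon>"
  shows "D (cls (\<lambda>n. x)) (cls s) \<le> \<epsilon>"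
  using assms
  by (intro tendsto_upperbound[OF tendsto_D[OF const_cauchy_seqs]])
    (auto simp: eventually_sequentially)

text \<open>A class is approximated by the constant sequence at a late enough term of any of its
  representatives.\<close>

lemma const_dense:
  assumes "X \<in> carrier (completion_group T)" "\<epsilon> > 0"
  obtains x where "x \<in> L" "D (cls (\<lambda>n. x)) X < \<epsilon>"
proof -
  obtain s where s: "s \<in> cauchy_seqs T" "X = cls s"
    using assms by (auto simp: carrier_completion)
  have "\<epsilon> / 2 > 0" using assms by simp
  with s(1) obtain M where M: "\<forall>m\<ge>M. \<forall>n\<ge>M. N (s m - s n) < \<epsilon> / 2"
    unfolding cauchy_seqs_iff by meson
  have "D (cls (\<lambda>n. s M)) X \<le> \<epsilon> / 2"
    unfolding s(2) using s(1) M by (intro D_const_le[of _ _ M]) (auto simp: cauchy_seqs_mem less_imp_le)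
  then show thesis
    using s(1) \<open>\<epsilon> > 0\<close> by (intro that[of "s M"]) (auto simp: cauchy_seqs_mem)
qed

text \<open>Approximate the \<open>n\<close>-th class by a single element \<open>x n\<close> of
  \<open>L\<close> with an error tending to 0. The sequence \<open>x\<close> is then Cauchy in
  \<open>L\<close>, and its own class is the limit.\<close>

lemma mcomplete_completion: "H.mcomplete"
  unfolding H.mcomplete_def
proof (intro allI impI)
  fix \<sigma> assume \<sigma>: "H.MCauchy \<sigma>"
  then have \<sigma>_mem: "\<sigma> n \<in> carrier (completion_group T)" for n
    by (auto simp: H.MCauchy_def)
  \<comment> \<open>The shift to \<open>Suc n\<close> keeps the tolerance positive at
    \<open>n = 0\<close>, as \<open>inverse 0\<close> is 0.\<close>
  have "\<exists>x. x \<in> L \<and> D (cls (\<lambda>n. x)) (\<sigma> n) < inverse (real (Suc n))" for n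
    using const_dense[OF \<sigma>_mem, of "inverse (real (Suc n))" n] by auto
  then obtain x where x: "x n \<in> L" "D (cls (\<lambda>k. x n)) (\<sigma> n) < inverse (real (Suc n))" for n
    by metis
  have approx: "\<exists>M. \<forall>n\<ge>M. D (cls (\<lambda>k. x n)) (\<sigma> n) < \<epsilon>" if \<epsilon>: "\<epsilon> > 0" for \<epsilon>
  proof -
    obtain M where M: "inverse (real (Suc M)) < \<epsilon>" using reals_Archimedean[OF \<epsilon>] by auto
    have "D (cls (\<lambda>k. x n)) (\<sigma> n) < \<epsilon>" if "n \<ge> M" for n
    proof -
      have "inverse (real (Suc n)) \<le> inverse (real (Suc M))"
        using that by (intro le_imp_inverse_le) auto
      then show ?thesis using x(2)[of n] M by linarith
    qed
    then show ?thesis by blast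
  qed
  have x_car: "cls (\<lambda>k. x n) \<in> carrier (completion_group T)" for n
    by (simp add: cls_mem_carrier const_cauchy_seqs x)
  have x_cauchy: "x \<in> cauchy_seqs T"
    unfolding cauchy_seqs_iff
  proof (intro conjI allI impI)
    show "x n \<in> L" for n by (rule x)
    fix \<epsilon> :: real assume "\<epsilon> > 0"
    then have "\<epsilon> / 3 > 0" by simp
    obtain M where M: "\<And>n. n \<ge> M \<Longrightarrow> D (cls (\<lambda>k. x n)) (\<sigma> n) < \<epsilon> / 3"
      using approx[OF \<open>\<epsilon> / 3 > 0\<close>] by blast
    obtain M' where M': "\<And>m n. m \<ge> M' \<Longrightarrow> n \<ge> M' \<Longrightarrow> D (\<sigma> m) (\<sigma> n) < \<epsilon> / 3"
      using \<sigma> \<open>\<epsilon> / 3 > 0\<close> unfolding H.MCauchy_def by meson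
    have "N (x m - x n) < \<epsilon>" if "m \<ge> max M M'" "n \<ge> max M M'" for m n
    proof -
      have "N (x m - x n) = D (cls (\<lambda>k. x m)) (cls (\<lambda>k. x n))"
        by (simp add: D_const x)
      also have "\<dots> \<le> D (cls (\<lambda>k. x m)) (\<sigma> m) + D (\<sigma> m) (\<sigma> n) + D (cls (\<lambda>k. x n)) (\<sigma> n)"
        using H.triangle[OF x_car \<sigma>_mem x_car, of m n m]
          H.triangle'[OF \<sigma>_mem \<sigma>_mem x_car, of m n n] by linarith
      also have "\<dots> < \<epsilon> / 3 + \<epsilon> / 3 + \<epsilon> / 3"
        using that by (intro add_strict_mono M M') auto
      finally show ?thesis by simp
    qed
    then show "\<exists>M. \<forall>m\<ge>M. \<forall>n\<ge>M. N (x m - x n) < \<epsilon>" by blast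
  qed
  have "\<forall>\<^sub>F n in sequentially. D (\<sigma> n) (cls x) < \<epsilon>" if "\<epsilon> > 0" for \<epsilon>
  proof -
    have "\<epsilon> / 2 > 0" using that by simp
    obtain M where M: "\<And>n. n \<ge> M \<Longrightarrow> D (cls (\<lambda>k. x n)) (\<sigma> n) < \<epsilon> / 2"
      using approx[OF \<open>\<epsilon> / 2 > 0\<close>] by blast
    obtain M' where M': "\<forall>m\<ge>M'. \<forall>n\<ge>M'. N (x m - x n) < \<epsilon> / 2"
      using x_cauchy \<open>\<epsilon> / 2 > 0\<close> unfolding cauchy_seqs_iff by meson
    have "D (\<sigma> n) (cls x) < \<epsilon>" if n: "n \<ge> max M M'" for n
    proof -
      have "D (\<sigma> n) (cls x) \<le> D (cls (\<lambda>k. x n)) (\<sigma> n) + D (cls (\<lambda>k. x n)) (cls x)"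
        by (rule H.triangle''[OF \<sigma>_mem x_car cls_mem_carrier[OF x_cauchy]])
      moreover have "D (cls (\<lambda>k. x n)) (\<sigma> n) < \<epsilon> / 2" using n by (intro M) auto
      moreover have "D (cls (\<lambda>k. x n)) (cls x) \<le> \<epsilon> / 2"
        using n M' by (intro D_const_le[OF x(1) x_cauchy, of M']) (auto intro: less_imp_le)
      ultimately show ?thesis by linarith
    qed
    then show ?thesis unfolding eventually_sequentially by blast
  qed
  then show "\<exists>X. limitin H.mtopology \<sigma> X sequentially"
    using x_cauchy by (intro exI[of _ "cls x"]) (simp add: H.limitin_metric cls_mem_carrier \<sigma>_mem)
qed

text \<open>The hypothesis makes one ball of \<open>L\<close> around 0 totally bounded. Translation
  and density transfer this to a ball around each point of the completion, and by completeness the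
  closure of that ball is compact.\<close>

lemma locally_compact_completion:
  assumes "r > 0"
    and tb: "\<And>\<delta>. \<delta> > 0 \<Longrightarrow> \<exists>F. finite F \<and> F \<subseteq> L \<and> (\<forall>x\<in>L. N x < r \<longrightarrow> (\<exists>k\<in>F. N (x - k) < \<delta>))"
  shows "locally_compact_space H.mtopology"
  unfolding locally_compact_space_def H.topspace_mtopology
proof (intro ballI)
  fix X assume X: "X \<in> carrier (completion_group T)"
  \<comment> \<open>Three errors below \<open>r / 3\<close> will be added: from \<open>b\<close> to
    \<open>Y\<close>, from \<open>Y\<close> to \<open>X\<close> and from \<open>X\<close> to
    \<open>a\<close>. Hence \<open>b - a\<close> lies in the ball of radius
    \<open>r\<close>.\<close>
  have r3: "r / 3 > 0" using \<open>r > 0\<close> by simp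
  obtain a where a: "a \<in> L" "D (cls (\<lambda>n. a)) X < r / 3"
    using const_dense[OF X r3] by blast
  have "H.mtotally_bounded (H.mball X (r / 3))"
  proof (rule H.mtotally_boundedI)
    show "H.mball X (r / 3) \<subseteq> carrier (completion_group T)" by (rule H.mball_subset_mspace)
    fix \<epsilon> :: real assume "\<epsilon> > 0"
    then obtain F where F: "finite F" "F \<subseteq> L" "\<And>x. x \<in> L \<Longrightarrow> N x < r \<Longrightarrow> \<exists>k\<in>F. N (x - k) < \<epsilon> / 2"
      using tb[of "\<epsilon> / 2"] by auto
    \<comment> \<open>The finite net of the ball around 0 is translated by \<open>a\<close>, the
      approximation of \<open>X\<close>.\<close>
    define K where "K = (\<lambda>k. cls (\<lambda>n. a + k)) ` F"
    have "H.mball X (r / 3) \<subseteq> (\<Union>Z\<in>K. H.mball Z \<epsilon>)"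
    proof
      fix Y assume "Y \<in> H.mball X (r / 3)"
      then have Y: "Y \<in> carrier (completion_group T)" "D X Y < r / 3" by (auto simp: H.in_mball)
      \<comment> \<open>The bound \<open>r / 3\<close> brings \<open>b - a\<close> within reach of
        the net; the bound \<open>\<epsilon> / 2\<close> serves the final distance estimate.\<close>
      have "min (\<epsilon> / 2) (r / 3) > 0" using r3 \<open>\<epsilon> > 0\<close> by simp
      from const_dense[OF Y(1) this] obtain b
        where b: "b \<in> L" "D (cls (\<lambda>n. b)) Y < min (\<epsilon> / 2) (r / 3)" by blast
      have car: "cls (\<lambda>n. x) \<in> carrier (completion_group T)" if "x \<in> L" for x
        using that by (simp add: cls_mem_carrier const_cauchy_seqs)
      have "N (b - a) = D (cls (\<lambda>n. b)) (cls (\<lambda>n. a))" using a b by (simp add: D_const)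
      also have "\<dots> \<le> D (cls (\<lambda>n. b)) Y + (D X Y + D (cls (\<lambda>n. a)) X)"
        using H.triangle[OF car[OF b(1)] Y(1) car[OF a(1)]]
          H.triangle[OF Y(1) X car[OF a(1)]] H.commute[of X Y] H.commute[of "cls (\<lambda>n. a)" X]
        by linarith
      also have "\<dots> < r" using a(2) b(2) Y(2) by linarith
      finally obtain k where k: "k \<in> F" "N (b - a - k) < \<epsilon> / 2"
        using F(3)[of "b - a"] a b diff_mem by blast
      have ak: "a + k \<in> L" using a(1) k(1) F(2) add_mem by blast
      have "D (cls (\<lambda>n. a + k)) Y \<le> D (cls (\<lambda>n. b)) (cls (\<lambda>n. a + k)) + D (cls (\<lambda>n. b)) Y"
        by (rule H.triangle''[OF car[OF ak] car[OF b(1)] Y(1)])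
      also have "D (cls (\<lambda>n. b)) (cls (\<lambda>n. a + k)) = N (b - a - k)"
        using b ak by (simp add: D_const algebra_simps)
      finally have "D (cls (\<lambda>n. a + k)) Y < \<epsilon>" using k b by linarith
      then show "Y \<in> (\<Union>Z\<in>K. H.mball Z \<epsilon>)"
        using k(1) car[OF ak] Y(1) by (auto simp: K_def H.in_mball)
    qed
    moreover have "finite K" using F(1) by (simp add: K_def)
    ultimately show "\<exists>K. finite K \<and> H.mball X (r / 3) \<subseteq> (\<Union>Z\<in>K. H.mball Z \<epsilon>)" by blast
  qed
  then have "compactin H.mtopology (H.mtopology closure_of H.mball X (r / 3))"
    using H.mtotally_bounded_eq_compact_closure_of[OF mcomplete_completion] by blast
  moreover have "H.mball X (r / 3) \<subseteq> H.mtopology closure_of H.mball X (r / 3)"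
    by (simp add: closure_of_subset H.mball_subset_mspace)
  ultimately show "\<exists>U K. openin H.mtopology U \<and> compactin H.mtopology K \<and> X \<in> U \<and> U \<subseteq> K"
    using X r3 by (intro exI[of _ "H.mball X (r / 3)"] exI[of _ "H.mtopology closure_of H.mball X (r / 3)"]) auto
qed

lemma locally_compact_abelian_group_completion:
  assumes "r > 0"
    and "\<And>\<delta>. \<delta> > 0 \<Longrightarrow> \<exists>F. finite F \<and> F \<subseteq> L \<and> (\<forall>x\<in>L. N x < r \<longrightarrow> (\<exists>k\<in>F. N (x - k) < \<delta>))"
  shows "locally_compact_abelian_group (completion_group T) (completion_topology T)"
  unfolding locally_compact_abelian_group_def completion_topology_eq
  using comm_group_completion continuous_map_mult continuous_map_inv
    locally_compact_completion[OF assms] H.Hausdorff_space_mtopology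
  by simp

end

section \<open>The AC topology\<close>

text \<open>Four consequences of positive definiteness, singled out because each is inherited by
  nonnegative multiples and by pointwise limits.\<close>

definition krein_function :: "('a::ab_group_add \<Rightarrow> complex) \<Rightarrow> bool" where
  "krein_function f \<longleftrightarrow>
     (\<forall>z. f (- z) = cnj (f z)) \<and>
     (\<forall>z. Re (f z) \<le> Re (f 0)) \<and>
     (\<forall>s t. sqrt (Re (f 0) - Re (f (s + t))) \<le> sqrt (Re (f 0) - Re (f s)) + sqrt (Re (f 0) - Re (f t))) \<and>
     (\<forall>z. (norm (f 0 - f z))\<^sup>2 \<le> 2 * Re (f 0) * (Re (f 0) - Re (f z)))"

lemma krein_function_autocorrelation:
  assumes "norm_summable u"
  shows "krein_function (autocorrelation u)"
  unfolding krein_function_def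
  using autocorrelation_minus Re_autocorrelation_le[OF assms] autocorrelation_triangle[OF assms]
    autocorrelation_krein_inequality[OF assms] by blast

lemma krein_function_scale:
  assumes f: "krein_function f" and "0 \<le> c"
  shows "krein_function (\<lambda>z. complex_of_real c * f z)"
  unfolding krein_function_def
proof (intro conjI allI)
  show "complex_of_real c * f (- z) = cnj (complex_of_real c * f z)" for z
    using f by (simp add: krein_function_def)
  show "Re (complex_of_real c * f z) \<le> Re (complex_of_real c * f 0)" for z
    using f \<open>0 \<le> c\<close> by (simp add: krein_function_def mult_left_mono)
  show "sqrt (Re (complex_of_real c * f 0) - Re (complex_of_real c * f (s + t))) \<le>
      sqrt (Re (complex_of_real c * f 0) - Re (complex_of_real c * f s)) +
      sqrt (Re (complex_of_real c * f 0) - Re (complex_of_real c * f t))" for s t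
  proof -
    have "sqrt c * sqrt (Re (f 0) - Re (f (s + t))) \<le>
        sqrt c * (sqrt (Re (f 0) - Re (f s)) + sqrt (Re (f 0) - Re (f t)))"
      using f \<open>0 \<le> c\<close> by (intro mult_left_mono) (auto simp: krein_function_def)
    then show ?thesis by (simp add: real_sqrt_mult distrib_left flip: right_diff_distrib)
  qed
  show "(norm (complex_of_real c * f 0 - complex_of_real c * f z))\<^sup>2 \<le>
      2 * Re (complex_of_real c * f 0) * (Re (complex_of_real c * f 0) - Re (complex_of_real c * f z))" for z
  proof -
    have "c\<^sup>2 * (norm (f 0 - f z))\<^sup>2 \<le> c\<^sup>2 * (2 * Re (f 0) * (Re (f 0) - Re (f z)))"
      using f by (intro mult_left_mono) (auto simp: krein_function_def)
    moreover have "(norm (complex_of_real c * f 0 - complex_of_real c * f z))\<^sup>2 = c\<^sup>2 * (norm (f 0 - f z))\<^sup>2"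
      by (simp add: norm_mult power_mult_distrib flip: right_diff_distrib)
    ultimately show ?thesis by (simp add: power2_eq_square algebra_simps)
  qed
qed

text \<open>Every condition is an equation or a weak inequality between continuous expressions in
  finitely many values. It is assumed only eventually because the conditions on \<open>A n\<close>
  begin at \<open>n = 1\<close>.\<close>

lemma krein_function_limit:
  assumes lim: "\<And>z. (\<lambda>n. g n z) \<longlonglongrightarrow> f z" and g: "\<forall>\<^sub>F n in sequentially. krein_function (g n)"
  shows "krein_function f"
  unfolding krein_function_def
proof (intro conjI allI)
  show "f (- z) = cnj (f z)" for z
  proof (rule LIMSEQ_unique[OF lim[of "- z"]])
    show "(\<lambda>n. g n (- z)) \<longlonglongrightarrow> cnj (f z)"
      using tendsto_cnj[OF lim[of z]]
      by (rule Lim_transform_eventually)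
        (use g in eventually_elim, simp add: krein_function_def)
  qed
  show "Re (f z) \<le> Re (f 0)" for z
    by (rule tendsto_le[OF _ tendsto_Re[OF lim] tendsto_Re[OF lim]])
      (simp, use g in eventually_elim, simp add: krein_function_def)
  show "sqrt (Re (f 0) - Re (f (s + t))) \<le> sqrt (Re (f 0) - Re (f s)) + sqrt (Re (f 0) - Re (f t))" for s t
  proof (rule tendsto_le)
    show "(\<lambda>n. sqrt (Re (g n 0) - Re (g n (s + t)))) \<longlonglongrightarrow> sqrt (Re (f 0) - Re (f (s + t)))"
      by (intro tendsto_intros lim)
    show "(\<lambda>n. sqrt (Re (g n 0) - Re (g n s)) + sqrt (Re (g n 0) - Re (g n t))) \<longlonglongrightarrow>
        sqrt (Re (f 0) - Re (f s)) + sqrt (Re (f 0) - Re (f t))"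
      by (intro tendsto_intros lim)
    show "\<forall>\<^sub>F n in sequentially. sqrt (Re (g n 0) - Re (g n (s + t))) \<le>
        sqrt (Re (g n 0) - Re (g n s)) + sqrt (Re (g n 0) - Re (g n t))"
      using g by eventually_elim (simp add: krein_function_def)
  qed simp
  show "(norm (f 0 - f z))\<^sup>2 \<le> 2 * Re (f 0) * (Re (f 0) - Re (f z))" for z
  proof (rule tendsto_le)
    show "(\<lambda>n. (norm (g n 0 - g n z))\<^sup>2) \<longlonglongrightarrow> (norm (f 0 - f z))\<^sup>2"
      by (intro tendsto_intros lim)
    show "(\<lambda>n. 2 * Re (g n 0) * (Re (g n 0) - Re (g n z))) \<longlonglongrightarrow> 2 * Re (f 0) * (Re (f 0) - Re (f z))"
      by (intro tendsto_intros lim)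
    show "\<forall>\<^sub>F n in sequentially. (norm (g n 0 - g n z))\<^sup>2 \<le> 2 * Re (g n 0) * (Re (g n 0) - Re (g n z))"
      using g by eventually_elim (simp add: krein_function_def)
  qed simp
qed

section \<open>The truncated comb and its autocorrelation coefficients\<close>

lemma norm_summable_restrict_comb:
  assumes tb: "translation_bounded_comb S w" and B: "relatively_compact B"
  shows "norm_summable (\<lambda>x. if x \<in> S \<inter> B then w x else 0)"
proof -
  have "(\<Sum>\<^sub>\<infinity>x\<in>S \<inter> closure B. ennreal (norm (w x))) \<le>
      (SUP t. \<Sum>\<^sub>\<infinity>x\<in>S \<inter> (+) t ` closure B. ennreal (norm (w x)))"
    \<comment> \<open>Translation boundedness is used for the compact set \<open>closure B\<close>
      with the shift 0.\<close>
    by (rule SUP_upper2[of 0]) auto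
  also have "\<dots> < \<infinity>"
    using tb B by (simp add: translation_bounded_comb_def relatively_compact_def)
  finally have fin: "(\<Sum>\<^sub>\<infinity>x\<in>S \<inter> closure B. ennreal (norm (w x))) < \<infinity>" .
  have "(\<lambda>x. norm (w x)) summable_on S \<inter> B"
  proof (rule nonneg_bdd_above_summable_on)
    show "bdd_above (sum (\<lambda>x. norm (w x)) ` {F. F \<subseteq> S \<inter> B \<and> finite F})"
    proof (rule bdd_aboveI2)
      fix F assume F: "F \<in> {F. F \<subseteq> S \<inter> B \<and> finite F}"
      have "ennreal (\<Sum>x\<in>F. norm (w x)) = (\<Sum>x\<in>F. ennreal (norm (w x)))"
        by (simp add: sum_ennreal)
      also have "\<dots> \<le> (\<Sum>\<^sub>\<infinity>x\<in>S \<inter> closure B. ennreal (norm (w x)))"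
        using F closure_subset[of B]
        by (subst nonneg_infsum_complete) (auto intro!: SUP_upper)
      \<comment> \<open>The extended sum is finite, so it can be read as a real bound for all finite
        partial sums.\<close>
      also have "\<dots> = ennreal (enn2real (\<Sum>\<^sub>\<infinity>x\<in>S \<inter> closure B. ennreal (norm (w x))))"
        using fin by (simp add: less_top)
      finally show "(\<Sum>x\<in>F. norm (w x)) \<le> enn2real (\<Sum>\<^sub>\<infinity>x\<in>S \<inter> closure B. ennreal (norm (w x)))"
        by (simp add: ennreal_le_iff)
    qed
  qed simp
  then show ?thesis
    by (rule summable_on_cong_neutral[THEN iffD1, rotated -1]) auto
qed

text \<open>The pairs with difference \<open>z\<close> are parametrized by their second component
  \<open>y\<close>, the first one being \<open>y + z\<close>. Cutting the weight off outside
  \<open>S \<inter> A n\<close> turns this into a sum over the whole group.\<close>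

lemma eta_approx_eq_autocorrelation:
  "eta_approx \<theta> A S w n z = of_real (1 / measure \<theta> (A n)) *
     autocorrelation (\<lambda>x. if x \<in> S \<inter> A n then w x else 0) z"
proof -
  define u where "u = (\<lambda>x. if x \<in> S \<inter> A n then w x else 0)"
  define Y where "Y = {y. y \<in> S \<inter> A n \<and> y + z \<in> S \<inter> A n}"
  have "bij_betw (\<lambda>y. (y + z, y)) Y {(x, y). x \<in> S \<inter> A n \<and> y \<in> S \<inter> A n \<and> x - y = z}"
    by (rule bij_betwI[where g = snd]) (auto simp: Y_def)
  from infsum_reindex_bij_betw[OF this, of "\<lambda>(x, y). w x * cnj (w y)"]
  have "(\<Sum>\<^sub>\<infinity>(x, y)\<in>{(x, y). x \<in> S \<inter> A n \<and> y \<in> S \<inter> A n \<and> x - y = z}. w x * cnj (w y)) =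
      (\<Sum>\<^sub>\<infinity>y\<in>Y. w (y + z) * cnj (w y))" by simp
  also have "\<dots> = autocorrelation u z"
    unfolding autocorrelation_def by (rule infsum_cong_neutral) (auto simp: u_def Y_def)
  finally have *: "(\<Sum>\<^sub>\<infinity>(x, y)\<in>{(x, y). x \<in> S \<inter> A n \<and> y \<in> S \<inter> A n \<and> x - y = z}. w x * cnj (w y)) =
      autocorrelation u z" .
  \<comment> \<open>This matches the default value 0 of \<open>eta_approx\<close> off the difference
    set.\<close>
  moreover have "autocorrelation u z = 0" if "z \<notin> difference_set S"
  proof -
    have "u (y + z) * cnj (u y) = 0" for y
    proof (rule ccontr)
      assume "u (y + z) * cnj (u y) \<noteq> 0"
      then have "y + z \<in> S" "y \<in> S" by (auto simp: u_def split: if_splits)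
      moreover have "z = (y + z) - y" by simp
      ultimately show False using that unfolding difference_set_def by blast
    qed
    then show ?thesis unfolding autocorrelation_def by (simp only: infsum_0)
  qed
  ultimately show ?thesis by (simp add: eta_approx_def u_def)
qed

text \<open>Off the difference set all approximants are 0, so convergence on that set already gives
  convergence at every \<open>z\<close>.\<close>

lemma
  assumes conv: "\<And>z. z \<in> difference_set S \<Longrightarrow> convergent (\<lambda>n. eta_approx \<theta> A S w n z)"
  shows eta_approx_tendsto: "(\<lambda>n. eta_approx \<theta> A S w n z) \<longlonglongrightarrow> eta \<theta> A S w z"
    and eta_eq_0: "z \<notin> difference_set S \<Longrightarrow> eta \<theta> A S w z = 0"
proof -
  have 0: "(\<lambda>n. eta_approx \<theta> A S w n z) \<longlonglongrightarrow> 0" if "z \<notin> difference_set S"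
    using that by (simp add: eta_approx_def)
  then show "z \<notin> difference_set S \<Longrightarrow> eta \<theta> A S w z = 0"
    unfolding eta_def by (intro limI)
  have "convergent (\<lambda>n. eta_approx \<theta> A S w n z)"
    using conv 0 by (cases "z \<in> difference_set S") (auto simp: convergent_def)
  then show "(\<lambda>n. eta_approx \<theta> A S w n z) \<longlonglongrightarrow> eta \<theta> A S w z"
    by (simp add: eta_def convergent_LIMSEQ_iff)
qed

lemma krein_function_eta:
  assumes "\<And>n. n \<ge> 1 \<Longrightarrow> relatively_compact (A n)"
    and "translation_bounded_comb S w"
    and "\<And>z. z \<in> difference_set S \<Longrightarrow> convergent (\<lambda>n. eta_approx \<theta> A S w n z)"
  shows "krein_function (eta \<theta> A S w)"
proof (rule krein_function_limit)
  show "(\<lambda>n. eta_approx \<theta> A S w n z) \<longlonglongrightarrow> eta \<theta> A S w z" for z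
    by (rule eta_approx_tendsto[OF assms(3)])
  have "krein_function (eta_approx \<theta> A S w n)" if "n \<ge> 1" for n
    unfolding eta_approx_eq_autocorrelation[abs_def]
    using that
    by (intro krein_function_scale krein_function_autocorrelation norm_summable_restrict_comb assms) auto
  then show "\<forall>\<^sub>F n in sequentially. krein_function (eta_approx \<theta> A S w n)"
    by (auto simp: eventually_sequentially)
qed

section \<open>Comparison of the seminorm with the AC pseudo-metric\<close>

definition krein_norm :: "('a::ab_group_add \<Rightarrow> complex) \<Rightarrow> 'a \<Rightarrow> real" where
  "krein_norm f z = sqrt (1 - Re (f z) / Re (f 0))"

context
  fixes f :: "'a::ab_group_add \<Rightarrow> complex"
  assumes f: "krein_function f" and f0: "f 0 \<in> \<real>" "Re (f 0) > 0"
begin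

lemma krein_norm_eq: "krein_norm f z = sqrt (Re (f 0) - Re (f z)) / sqrt (Re (f 0))"
  using f0 by (simp add: krein_norm_def diff_divide_distrib flip: real_sqrt_divide)

lemma ac_dist_eq: "ac_dist f s t = sqrt (norm (f 0 - f (s - t)) / Re (f 0))"
proof -
  have f0': "f 0 = of_real (Re (f 0))" using f0(1) by simp
  have "f 0 \<noteq> 0" using f0(2) by auto
  then have "1 - f (s - t) / f 0 = (f 0 - f (s - t)) / f 0"
    by (simp add: diff_divide_distrib)
  then have "norm (1 - f (s - t) / f 0) = norm (f 0 - f (s - t)) / norm (f 0)"
    by (simp add: norm_divide)
  moreover have "norm (f 0) = Re (f 0)"
    by (subst f0', subst norm_of_real) (use f0(2) in simp)
  ultimately show ?thesis by (simp add: ac_dist_def)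
qed

text \<open>A real part is at most the modulus. The seminorm is built from the real part because
  that is what the l2 distance of translates computes.\<close>

lemma krein_norm_le_ac_dist: "krein_norm f (s - t) \<le> ac_dist f s t"
  unfolding krein_norm_eq ac_dist_eq real_sqrt_divide[symmetric]
  using f0(2) complex_Re_le_cmod[of "f 0 - f (s - t)"]
  by (intro real_sqrt_le_mono divide_right_mono) auto

text \<open>Here \<open>q\<close> is the square of \<open>ac_dist f s t\<close>. Krein's inequality
  bounds the square of \<open>q\<close> by twice the square of \<open>krein_norm\<close>, which is
  loosened to \<open>q \<le> 2 * krein_norm f z\<close>; hence the radius
  \<open>\<epsilon>\<^sup>2 / 2\<close>.\<close>

lemma ac_dist_less:
  assumes "\<epsilon> > 0" "krein_norm f (s - t) < \<epsilon>\<^sup>2 / 2"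
  shows "ac_dist f s t < \<epsilon>"
proof -
  define z where "z = s - t"
  define q where "q = norm (f 0 - f z) / Re (f 0)"
  have nn: "0 \<le> Re (f 0) - Re (f z)" using f by (simp add: krein_function_def)
  have "q\<^sup>2 \<le> 2 * Re (f 0) * (Re (f 0) - Re (f z)) / (Re (f 0))\<^sup>2"
    using f unfolding q_def power_divide krein_function_def by (intro divide_right_mono) auto
  also have "\<dots> = 2 * (krein_norm f z)\<^sup>2"
    using nn f0(2) by (simp add: krein_norm_eq power_divide power2_eq_square)
  also have "\<dots> \<le> (2 * krein_norm f z)\<^sup>2"
    by (simp add: power_mult_distrib)
  finally have "q \<le> 2 * krein_norm f z"
    by (rule power2_le_imp_le) (use nn f0(2) in \<open>simp add: krein_norm_eq\<close>)
  also have "\<dots> < \<epsilon>\<^sup>2" using assms by (simp add: z_def)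
  finally have "sqrt q < sqrt (\<epsilon>\<^sup>2)" by (rule real_sqrt_less_mono)
  then show ?thesis
    using assms(1) by (simp add: ac_dist_eq q_def z_def)
qed

text \<open>The two comparisons with \<open>ac_dist\<close> show that both families of balls define
  the same open sets.\<close>

lemma seminormed_subgroup_ac_group:
  "seminormed_subgroup (ac_group f) (krein_norm f) (ac_topology f)"
proof
  show "0 \<in> ac_group f" by (simp add: ac_group_def)
  show "x - y \<in> ac_group f" if "x \<in> ac_group f" "y \<in> ac_group f" for x y
    using that unfolding ac_group_def by (rule group_closure.diff)
  show "krein_norm f 0 = 0" using f0 by (simp add: krein_norm_def)
  show minus: "krein_norm f (- x) = krein_norm f x" for x
    using f by (simp add: krein_norm_def krein_function_def)
  show "krein_norm f (x + y) \<le> krein_norm f x + krein_norm f y" for x y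
    unfolding krein_norm_eq add_divide_distrib[symmetric]
    using f f0(2) by (intro divide_right_mono) (auto simp: krein_function_def)
  show "openin (ac_topology f) U \<longleftrightarrow> U \<subseteq> ac_group f \<and>
      (\<forall>x\<in>U. \<exists>\<epsilon>>0. {y \<in> ac_group f. krein_norm f (y - x) < \<epsilon>} \<subseteq> U)" for U
  proof -
    \<comment> \<open>\<open>ac_dist f x y\<close> looks at \<open>x - y\<close>, the locale at
      \<open>y - x\<close>; symmetry reconciles them.\<close>
    have *: "krein_norm f (y - x) = krein_norm f (x - y)" for x y
      using minus[of "x - y"] by simp
    have "(\<exists>\<epsilon>>0. {y \<in> ac_group f. ac_dist f x y < \<epsilon>} \<subseteq> U) \<longleftrightarrow>
      (\<exists>\<epsilon>>0. {y \<in> ac_group f. krein_norm f (y - x) < \<epsilon>} \<subseteq> U)" for x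
    proof (intro iffI; elim exE conjE)
      fix \<epsilon> :: real assume "\<epsilon> > 0" and U: "{y \<in> ac_group f. ac_dist f x y < \<epsilon>} \<subseteq> U"
      have "{y \<in> ac_group f. krein_norm f (y - x) < \<epsilon>\<^sup>2 / 2} \<subseteq> U"
        using U ac_dist_less[OF \<open>\<epsilon> > 0\<close>] * by auto
      then show "\<exists>\<epsilon>>0. {y \<in> ac_group f. krein_norm f (y - x) < \<epsilon>} \<subseteq> U"
        using \<open>\<epsilon> > 0\<close> by (intro exI[of _ "\<epsilon>\<^sup>2 / 2"]) auto
    next
      fix \<epsilon> :: real assume "\<epsilon> > 0" and U: "{y \<in> ac_group f. krein_norm f (y - x) < \<epsilon>} \<subseteq> U"
      have "{y \<in> ac_group f. ac_dist f x y < \<epsilon>} \<subseteq> U"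
      proof clarify
        fix y assume "y \<in> ac_group f" "ac_dist f x y < \<epsilon>"
        then show "y \<in> U"
          using U krein_norm_le_ac_dist[of x y] *[of y x] by auto
      qed
      then show "\<exists>\<epsilon>>0. {y \<in> ac_group f. ac_dist f x y < \<epsilon>} \<subseteq> U"
        using \<open>\<epsilon> > 0\<close> by blast
    qed
    then show ?thesis unfolding openin_ac_topology by simp
  qed
qed

text \<open>At a zero of \<open>f\<close> the seminorm is exactly 1.\<close>

lemma krein_norm_less_1D: "krein_norm f z < 1 \<Longrightarrow> f z \<noteq> 0"
  by (auto simp: krein_norm_def)

end

text \<open>An infinite intersection would have a limit point in \<open>K\<close>. Closedness puts
  that point into \<open>D\<close>, where discreteness makes it isolated.\<close>

lemma finite_compact_Int_closed_discrete:
  assumes "compact K" "closed D" "discrete D"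
  shows "finite (K \<inter> D)"
proof (rule finite_not_islimpt_in_compact[OF assms(1)])
  fix z assume "z \<in> K"
  show "\<not> z islimpt D"
  proof
    assume z: "z islimpt D"
    then have "z \<in> D" using assms(2) by (simp add: closed_limpt)
    with assms(3) have "z isolated_in D" by (rule discreteD)
    with z show False by (simp add: isolated_in_islimpt_iff)
  qed
qed

theorem proposition1:
  fixes \<theta> :: "'a::{topological_ab_group_add, t2_space} measure"
    and A :: "nat \<Rightarrow> 'a set"
    and S :: "'a set"
    and w :: "'a \<Rightarrow> complex"
    and \<omega> :: "'a set \<Rightarrow> complex"
    and \<eta> :: "'a \<Rightarrow> complex"
  defines "\<eta> \<equiv> eta \<theta> A S w"
  assumes "sigma_compact (UNIV :: 'a set)"
    and "locally_compact_space (euclidean :: 'a topology)"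
    and "haar_measure \<theta>"
    and "\<And>n. n \<ge> 1 \<Longrightarrow> open (A n) \<and> relatively_compact (A n)"
    and "A 1 \<noteq> {}"
    and "\<And>n. n \<ge> 1 \<Longrightarrow> closure (A n) \<subseteq> A (Suc n)"
    and "(\<Union>n\<in>{1..}. A n) = UNIV"
    and "countable S"
    and "complex_regular_borel_measure \<omega>"
    and "is_weighted_comb \<omega> S w"
    and "translation_bounded_comb S w"
    and "\<And>z. z \<in> difference_set S \<Longrightarrow> convergent (\<lambda>n. eta_approx \<theta> A S w n z)"
    and "\<eta> 0 \<in> \<real>" and "Re (\<eta> 0) > 0"
    and "closed (difference_set S)" and "discrete (difference_set S)"
    and "\<And>\<epsilon>. \<epsilon> > 0 \<Longrightarrow> relatively_dense (almost_periods \<eta> \<epsilon>)"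
  shows "locally_compact_abelian_group
           (completion_group (ac_topology \<eta>)) (completion_topology (ac_topology \<eta>))"
proof -
  have kr: "krein_function \<eta>"
    unfolding \<eta>_def using assms(5) by (intro krein_function_eta assms(12,13)) auto
  interpret seminormed_subgroup "ac_group \<eta>" "krein_norm \<eta>" "ac_topology \<eta>"
    by (rule seminormed_subgroup_ac_group[OF kr assms(14,15)])
  show ?thesis
  proof (rule locally_compact_abelian_group_completion)
    show "(1 / 2 :: real) > 0" by simp
    fix \<delta> :: real assume "\<delta> > 0"
    \<comment> \<open>The bound \<open>\<delta>\<close> is the wanted precision of the net. The
      bound \<open>1 / 2\<close> keeps \<open>krein_norm \<eta> x + krein_norm \<eta> p\<close>
      below 1.\<close>
    define \<epsilon> where "\<epsilon> = min \<delta> (1 / 2)"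
    have "\<epsilon> > 0" using \<open>\<delta> > 0\<close> by (simp add: \<epsilon>_def)
    then have "relatively_dense (almost_periods \<eta> \<epsilon>)" by (rule assms(18))
    then obtain K where K: "compact K" "{p + k | p k. p \<in> almost_periods \<eta> \<epsilon> \<and> k \<in> K} = UNIV"
      unfolding relatively_dense_def by (elim exE conjE)
    \<comment> \<open>The net consists of the essential differences in \<open>K\<close>. They
      generate \<open>ac_group \<eta>\<close>, so they lie in it.\<close>
    define F where "F = K \<inter> essential_differences \<eta>"
    have "essential_differences \<eta> \<subseteq> difference_set S"
      using eta_eq_0[OF assms(13)] by (auto simp: essential_differences_def \<eta>_def)
    then have "finite F"
      using finite_compact_Int_closed_discrete[OF K(1) assms(16,17)]
      by (rule_tac finite_subset[rotated]) (auto simp: F_def)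
    moreover have "F \<subseteq> ac_group \<eta>"
      by (auto simp: F_def ac_group_def intro: group_closure.base)
    moreover have "\<exists>k\<in>F. krein_norm \<eta> (x - k) < \<delta>" if "krein_norm \<eta> x < 1 / 2" for x
    proof -
      have "x \<in> {p + k | p k. p \<in> almost_periods \<eta> \<epsilon> \<and> k \<in> K}" by (simp add: K(2))
      then obtain p k where pk: "x = p + k" "p \<in> almost_periods \<eta> \<epsilon>" "k \<in> K" by blast
      have p: "krein_norm \<eta> p < \<epsilon>"
        using krein_norm_le_ac_dist[OF kr assms(14,15), of p 0] pk(2)
        by (simp add: almost_periods_def)
      \<comment> \<open>Since \<open>x - p\<close> is \<open>k\<close>, a seminorm below 1 makes
        \<open>k\<close> an essential difference and so a point of \<open>F\<close>.\<close>
      have "krein_norm \<eta> (x - p) \<le> krein_norm \<eta> x + krein_norm \<eta> p"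
        using N_triangle[of x "- p"] by (simp add: N_minus)
      also have "\<dots> < 1" using that p by (simp add: \<epsilon>_def)
      finally have "\<eta> k \<noteq> 0"
        using krein_norm_less_1D[of \<eta> k] kr assms(14,15) pk(1) by simp
      then have "k \<in> F" using pk(3) by (simp add: F_def essential_differences_def)
      \<comment> \<open>The difference \<open>x - k\<close> is the almost period
        \<open>p\<close>.\<close>
      moreover have "krein_norm \<eta> (x - k) < \<delta>" using p pk(1) by (simp add: \<epsilon>_def)
      ultimately show ?thesis by blast
    qed
    ultimately show "\<exists>F. finite F \<and> F \<subseteq> ac_group \<eta> \<and>
        (\<forall>x\<in>ac_group \<eta>. krein_norm \<eta> x < 1 / 2 \<longrightarrow> (\<exists>k\<in>F. krein_norm \<eta> (x - k) < \<delta>))"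
      by blast
  qed
qed

end
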